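(* Let $\mathcal{A}$ and $\mathcal{B}$ be abelian categories and let $F:\mathcal{A}\to\mathcal{B}$ be a faithful additive functor with left adjoint $L$ and right adjoint $R$, such that the classes of $F$-projective and $F$-injective objects of $\mathcal{A}$ coincide. If $X\to Y\to Z$ is a short exact sequence of cochain complexes over $\mathcal{A}$ such that $FX\to FY\to FZ$ is a split short exact sequence of complexes over $\mathcal{B}$, then there is a distinguished triangle $$X\to Y\to Z\to X[1]$$ in $D_F(\mathcal{A})$ (whose first two maps are the images of the given ones).
   Context: An object of $\mathcal{A}$ is $F$-projective if it is a direct summand of $LY$ for some $Y\in\mathcal{B}$, and $F$-injective if it is a direct summand of $RY$ for some $Y\in\mathcal{B}$. $\mathrm{K}(\mathcal{A})$ denotes the unbounded homotopy category of cochain complexes over $\mathcal{A}$. The functor $F$ is exact and induces $F:\mathrm{K}(\mathcal{A})\to\mathrm{K}(\mathcal{B})$; let $\mathcal{L}$ be the kernel of this induced functor, i.e. the complexes $S$ such that $FS$ is split acyclic (contractible). Set $D_F(\mathcal{A}):=\mathrm{K}(\mathcal{A})/\mathcal{L}$ (Verdier localization, with its induced triangulated structure). *)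

theory Defs
  imports "HOL-Algebra.Group"
begin

section \<open>Categories and functors\<close>

record ('o, 'm) cat =
  Ob :: "'o set"
  Mor :: "'m set"
  Src :: "'m \<Rightarrow> 'o"
  Tgt :: "'m \<Rightarrow> 'o"
  Idt :: "'o \<Rightarrow> 'm"
  Cmp :: "'m \<Rightarrow> 'm \<Rightarrow> 'm"  (infixr "\<odot>\<index>" 70)

definition Hom :: "('o, 'm, 'z) cat_scheme \<Rightarrow> 'o \<Rightarrow> 'o \<Rightarrow> 'm set" where
  "Hom C X Y = {f \<in> Mor C. Src C f = X \<and> Tgt C f = Y}"

locale category =
  fixes C :: "('o, 'm, 'z) cat_scheme" (structure)
  assumes Src_Ob: "f \<in> Mor C \<Longrightarrow> Src C f \<in> Ob C"
    and Tgt_Ob: "f \<in> Mor C \<Longrightarrow> Tgt C f \<in> Ob C"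
    and Idt_Hom: "X \<in> Ob C \<Longrightarrow> Idt C X \<in> Hom C X X"
    and Cmp_Hom: "f \<in> Hom C X Y \<Longrightarrow> g \<in> Hom C Y Z \<Longrightarrow> g \<odot> f \<in> Hom C X Z"
    and Cmp_Idt: "f \<in> Hom C X Y \<Longrightarrow> f \<odot> Idt C X = f"
    and Idt_Cmp: "f \<in> Hom C X Y \<Longrightarrow> Idt C Y \<odot> f = f"
    and Cmp_assoc: "f \<in> Hom C W X \<Longrightarrow> g \<in> Hom C X Y \<Longrightarrow> h \<in> Hom C Y Z \<Longrightarrow>
      (h \<odot> g) \<odot> f = h \<odot> (g \<odot> f)"

definition is_iso :: "('o, 'm, 'z) cat_scheme \<Rightarrow> 'm \<Rightarrow> bool" where
  "is_iso C f \<longleftrightarrow> f \<in> Mor C \<and>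
     (\<exists>g \<in> Hom C (Tgt C f) (Src C f).
        Cmp C g f = Idt C (Src C f) \<and> Cmp C f g = Idt C (Tgt C f))"

definition is_mono :: "('o, 'm, 'z) cat_scheme \<Rightarrow> 'm \<Rightarrow> bool" where
  "is_mono C f \<longleftrightarrow> f \<in> Mor C \<and>
     (\<forall>W. \<forall>a \<in> Hom C W (Src C f). \<forall>b \<in> Hom C W (Src C f). Cmp C f a = Cmp C f b \<longrightarrow> a = b)"

definition is_epi :: "('o, 'm, 'z) cat_scheme \<Rightarrow> 'm \<Rightarrow> bool" where
  "is_epi C f \<longleftrightarrow> f \<in> Mor C \<and>
     (\<forall>W. \<forall>a \<in> Hom C (Tgt C f) W. \<forall>b \<in> Hom C (Tgt C f) W. Cmp C a f = Cmp C b f \<longrightarrow> a = b)"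

definition zero_object :: "('o, 'm, 'z) cat_scheme \<Rightarrow> 'o \<Rightarrow> bool" where
  "zero_object C Z \<longleftrightarrow> Z \<in> Ob C \<and>
     (\<forall>X \<in> Ob C. (\<exists>!f. f \<in> Hom C X Z) \<and> (\<exists>!f. f \<in> Hom C Z X))"

record ('o, 'm, 'p, 'n) fnctr =
  FOb :: "'o \<Rightarrow> 'p"
  FMor :: "'m \<Rightarrow> 'n"

locale cat_functor = C: category C + D: category D
  for C :: "('o, 'm, 'y) cat_scheme" and D :: "('p, 'n, 'z) cat_scheme"
    and F :: "('o, 'm, 'p, 'n) fnctr" +
  assumes FOb: "X \<in> Ob C \<Longrightarrow> FOb F X \<in> Ob D"
    and FMor: "f \<in> Hom C X Y \<Longrightarrow> FMor F f \<in> Hom D (FOb F X) (FOb F Y)"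
    and FMor_Idt: "X \<in> Ob C \<Longrightarrow> FMor F (Idt C X) = Idt D (FOb F X)"
    and FMor_Cmp: "f \<in> Hom C X Y \<Longrightarrow> g \<in> Hom C Y Z \<Longrightarrow>
      FMor F (Cmp C g f) = Cmp D (FMor F g) (FMor F f)"

definition faithful_functor ::
  "('o, 'm, 'y) cat_scheme \<Rightarrow> ('p, 'n, 'z) cat_scheme \<Rightarrow> ('o, 'm, 'p, 'n) fnctr \<Rightarrow> bool" where
  "faithful_functor C D F \<longleftrightarrow> cat_functor C D F \<and>
     (\<forall>X \<in> Ob C. \<forall>Y \<in> Ob C. inj_on (FMor F) (Hom C X Y))"

text \<open>\<open>adjunction C D L R\<close>: the functor \<open>L\<close> from \<open>C\<close> to \<open>D\<close> is left adjoint to the functor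
  \<open>R\<close> from \<open>D\<close> to \<open>C\<close>.\<close>

definition adjunction ::
  "('o, 'm, 'y) cat_scheme \<Rightarrow> ('p, 'n, 'z) cat_scheme \<Rightarrow>
   ('o, 'm, 'p, 'n) fnctr \<Rightarrow> ('p, 'n, 'o, 'm) fnctr \<Rightarrow> bool" where
  "adjunction C D L R \<longleftrightarrow> cat_functor C D L \<and> cat_functor D C R \<and>
     (\<exists>\<phi>. (\<forall>X \<in> Ob C. \<forall>Y \<in> Ob D. bij_betw (\<phi> X Y) (Hom D (FOb L X) Y) (Hom C X (FOb R Y))) \<and>
          (\<forall>X \<in> Ob C. \<forall>Y \<in> Ob D. \<forall>X' \<in> Ob C. \<forall>Y' \<in> Ob D.
             \<forall>a \<in> Hom C X' X. \<forall>b \<in> Hom D Y Y'. \<forall>u \<in> Hom D (FOb L X) Y.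
               \<phi> X' Y' (Cmp D b (Cmp D u (FMor L a))) = Cmp C (FMor R b) (Cmp C (\<phi> X Y u) a)))"

section \<open>Additive structure and abelian categories\<close>

record ('o, 'm) add_cat = "('o, 'm) cat" +
  Add :: "'m \<Rightarrow> 'm \<Rightarrow> 'm"
  Zer :: "'o \<Rightarrow> 'o \<Rightarrow> 'm"

definition Hom_group :: "('o, 'm, 'z) add_cat_scheme \<Rightarrow> 'o \<Rightarrow> 'o \<Rightarrow> 'm monoid" where
  "Hom_group C X Y = \<lparr>carrier = Hom C X Y, mult = Add C, one = Zer C X Y\<rparr>"

definition Neg :: "('o, 'm, 'z) add_cat_scheme \<Rightarrow> 'm \<Rightarrow> 'm" where
  "Neg C f = m_inv (Hom_group C (Src C f) (Tgt C f)) f"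

locale preadditive_category = category C
  for C :: "('o, 'm, 'z) add_cat_scheme" (structure) +
  assumes Hom_comm_group: "X \<in> Ob C \<Longrightarrow> Y \<in> Ob C \<Longrightarrow> comm_group (Hom_group C X Y)"
    and Cmp_Add: "f \<in> Hom C X Y \<Longrightarrow> f' \<in> Hom C X Y \<Longrightarrow> g \<in> Hom C Y Z \<Longrightarrow>
      g \<odot> Add C f f' = Add C (g \<odot> f) (g \<odot> f')"
    and Add_Cmp: "f \<in> Hom C X Y \<Longrightarrow> g \<in> Hom C Y Z \<Longrightarrow> g' \<in> Hom C Y Z \<Longrightarrow>
      Add C g g' \<odot> f = Add C (g \<odot> f) (g' \<odot> f)"

text \<open>\<open>M\<close> is the direct sum of \<open>X\<close> and \<open>Y\<close>, with injections \<open>i\<close>, \<open>j\<close> and projections \<open>p\<close>, \<open>q\<close>.\<close>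

definition biproduct ::
  "('o, 'm, 'z) add_cat_scheme \<Rightarrow> 'o \<Rightarrow> 'o \<Rightarrow> 'o \<Rightarrow> 'm \<Rightarrow> 'm \<Rightarrow> 'm \<Rightarrow> 'm \<Rightarrow> bool" where
  "biproduct C X Y M i j p q \<longleftrightarrow>
     X \<in> Ob C \<and> Y \<in> Ob C \<and> M \<in> Ob C \<and>
     i \<in> Hom C X M \<and> j \<in> Hom C Y M \<and> p \<in> Hom C M X \<and> q \<in> Hom C M Y \<and>
     Cmp C p i = Idt C X \<and> Cmp C q j = Idt C Y \<and>
     Cmp C q i = Zer C X Y \<and> Cmp C p j = Zer C Y X \<and>
     Add C (Cmp C i p) (Cmp C j q) = Idt C M"

definition direct_summand :: "('o, 'm, 'z) add_cat_scheme \<Rightarrow> 'o \<Rightarrow> 'o \<Rightarrow> bool" where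
  "direct_summand C X M \<longleftrightarrow> (\<exists>Y i j p q. biproduct C X Y M i j p q)"

definition is_kernel :: "('o, 'm, 'z) add_cat_scheme \<Rightarrow> 'm \<Rightarrow> 'm \<Rightarrow> bool" where
  "is_kernel C k f \<longleftrightarrow> k \<in> Mor C \<and> f \<in> Mor C \<and> Tgt C k = Src C f \<and>
     Cmp C f k = Zer C (Src C k) (Tgt C f) \<and>
     (\<forall>W. \<forall>a \<in> Hom C W (Src C f). Cmp C f a = Zer C W (Tgt C f) \<longrightarrow>
        (\<exists>!u. u \<in> Hom C W (Src C k) \<and> Cmp C k u = a))"

definition is_cokernel :: "('o, 'm, 'z) add_cat_scheme \<Rightarrow> 'm \<Rightarrow> 'm \<Rightarrow> bool" where
  "is_cokernel C c f \<longleftrightarrow> c \<in> Mor C \<and> f \<in> Mor C \<and> Src C c = Tgt C f \<and>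
     Cmp C c f = Zer C (Src C f) (Tgt C c) \<and>
     (\<forall>W. \<forall>a \<in> Hom C (Tgt C f) W. Cmp C a f = Zer C (Src C f) W \<longrightarrow>
        (\<exists>!u. u \<in> Hom C (Tgt C c) W \<and> Cmp C u c = a))"

locale abelian_category = preadditive_category C
  for C :: "('o, 'm, 'z) add_cat_scheme" (structure) +
  assumes ex_zero_object: "\<exists>Z. zero_object C Z"
    and ex_biproduct: "X \<in> Ob C \<Longrightarrow> Y \<in> Ob C \<Longrightarrow> \<exists>M i j p q. biproduct C X Y M i j p q"
    and ex_kernel: "f \<in> Mor C \<Longrightarrow> \<exists>k. is_kernel C k f"
    and ex_cokernel: "f \<in> Mor C \<Longrightarrow> \<exists>c. is_cokernel C c f"
    and mono_normal: "is_mono C f \<Longrightarrow> \<exists>g. is_kernel C f g"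
    and epi_normal: "is_epi C f \<Longrightarrow> \<exists>g. is_cokernel C f g"

definition additive_functor ::
  "('o, 'm, 'y) add_cat_scheme \<Rightarrow> ('p, 'n, 'z) add_cat_scheme \<Rightarrow> ('o, 'm, 'p, 'n) fnctr \<Rightarrow> bool" where
  "additive_functor C D F \<longleftrightarrow> cat_functor C D F \<and>
     (\<forall>X \<in> Ob C. \<forall>Y \<in> Ob C. \<forall>f \<in> Hom C X Y. \<forall>g \<in> Hom C X Y.
        FMor F (Add C f g) = Add D (FMor F f) (FMor F g))"

definition short_exact :: "('o, 'm, 'z) add_cat_scheme \<Rightarrow> 'm \<Rightarrow> 'm \<Rightarrow> bool" where
  "short_exact C f g \<longleftrightarrow> is_kernel C f g \<and> is_cokernel C g f"

definition split_short_exact :: "('o, 'm, 'z) add_cat_scheme \<Rightarrow> 'm \<Rightarrow> 'm \<Rightarrow> bool" where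
  "split_short_exact C f g \<longleftrightarrow> short_exact C f g \<and>
     (\<exists>s \<in> Hom C (Tgt C g) (Src C g). Cmp C g s = Idt C (Tgt C g))"

text \<open>For \<open>F\<close> from \<open>A\<close> to \<open>B\<close> with left adjoint \<open>L\<close> and right adjoint \<open>R\<close>, these are the
  \<open>F\<close>-projective and the \<open>F\<close>-injective objects of \<open>A\<close>.\<close>

definition rel_projective ::
  "('o, 'm, 'y) add_cat_scheme \<Rightarrow> ('p, 'n, 'z) add_cat_scheme \<Rightarrow> ('p, 'n, 'o, 'm) fnctr \<Rightarrow> 'o \<Rightarrow> bool" where
  "rel_projective A B L X \<longleftrightarrow> (\<exists>Y \<in> Ob B. direct_summand A X (FOb L Y))"

definition rel_injective ::
  "('o, 'm, 'y) add_cat_scheme \<Rightarrow> ('p, 'n, 'z) add_cat_scheme \<Rightarrow> ('p, 'n, 'o, 'm) fnctr \<Rightarrow> 'o \<Rightarrow> bool" where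
  "rel_injective A B R X \<longleftrightarrow> (\<exists>Y \<in> Ob B. direct_summand A X (FOb R Y))"

section \<open>Cochain complexes\<close>

record ('o, 'm) cochain =
  cob :: "int \<Rightarrow> 'o"
  cdiff :: "int \<Rightarrow> 'm"

type_synonym ('o, 'm) cmap = "('o, 'm) cochain \<times> ('o, 'm) cochain \<times> (int \<Rightarrow> 'm)"

definition cochain_complex :: "('o, 'm, 'z) add_cat_scheme \<Rightarrow> ('o, 'm) cochain \<Rightarrow> bool" where
  "cochain_complex A X \<longleftrightarrow>
     (\<forall>n. cob X n \<in> Ob A) \<and> (\<forall>n. cdiff X n \<in> Hom A (cob X n) (cob X (n + 1))) \<and>
     (\<forall>n. Cmp A (cdiff X (n + 1)) (cdiff X n) = Zer A (cob X n) (cob X (n + 2)))"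

definition cochain_map ::
  "('o, 'm, 'z) add_cat_scheme \<Rightarrow> ('o, 'm) cochain \<Rightarrow> ('o, 'm) cochain \<Rightarrow> (int \<Rightarrow> 'm) \<Rightarrow> bool" where
  "cochain_map A X Y f \<longleftrightarrow>
     (\<forall>n. f n \<in> Hom A (cob X n) (cob Y n)) \<and>
     (\<forall>n. Cmp A (f (n + 1)) (cdiff X n) = Cmp A (cdiff Y n) (f n))"

definition Ch :: "('o, 'm, 'z) add_cat_scheme \<Rightarrow> (('o, 'm) cochain, ('o, 'm) cmap) add_cat" where
  "Ch A =
    \<lparr>Ob = {X. cochain_complex A X},
     Mor = {(X, Y, f). cochain_complex A X \<and> cochain_complex A Y \<and> cochain_map A X Y f},
     Src = (\<lambda>(X, Y, f). X),
     Tgt = (\<lambda>(X, Y, f). Y),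
     Idt = (\<lambda>X. (X, X, \<lambda>n. Idt A (cob X n))),
     Cmp = (\<lambda>(Y', Z, g) (X, Y, f). (X, Z, \<lambda>n. Cmp A (g n) (f n))),
     Add = (\<lambda>(X, Y, f) (X', Y', g). (X, Y, \<lambda>n. Add A (f n) (g n))),
     Zer = (\<lambda>X Y. (X, Y, \<lambda>n. Zer A (cob X n) (cob Y n)))\<rparr>"

definition Ch_fnctr ::
  "('o, 'm, 'p, 'n) fnctr \<Rightarrow>
   (('o, 'm) cochain, ('o, 'm) cmap, ('p, 'n) cochain, ('p, 'n) cmap) fnctr" where
  "Ch_fnctr F =
    (let Fc = (\<lambda>X. \<lparr>cob = \<lambda>n. FOb F (cob X n), cdiff = \<lambda>n. FMor F (cdiff X n)\<rparr>)
     in \<lparr>FOb = Fc, FMor = (\<lambda>(X, Y, f). (Fc X, Fc Y, \<lambda>n. FMor F (f n)))\<rparr>)"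

definition homotopy :: "('o, 'm, 'z) add_cat_scheme \<Rightarrow> (('o, 'm) cmap \<times> ('o, 'm) cmap) set" where
  "homotopy A = {((X, Y, f), (X', Y', g)).
     X' = X \<and> Y' = Y \<and> (X, Y, f) \<in> Mor (Ch A) \<and> (X, Y, g) \<in> Mor (Ch A) \<and>
     (\<exists>s. (\<forall>n. s n \<in> Hom A (cob X n) (cob Y (n - 1))) \<and>
          (\<forall>n. f n = Add A (g n)
                 (Add A (Cmp A (cdiff Y (n - 1)) (s n)) (Cmp A (s (n + 1)) (cdiff X n)))))}"

definition contractible :: "('o, 'm, 'z) add_cat_scheme \<Rightarrow> ('o, 'm) cochain \<Rightarrow> bool" where
  "contractible A X \<longleftrightarrow> cochain_complex A X \<and> (Idt (Ch A) X, Zer (Ch A) X X) \<in> homotopy A"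

definition cshift :: "('o, 'm, 'z) add_cat_scheme \<Rightarrow> ('o, 'm) cochain \<Rightarrow> ('o, 'm) cochain" where
  "cshift A X = \<lparr>cob = \<lambda>n. cob X (n + 1), cdiff = \<lambda>n. Neg A (cdiff X (n + 1))\<rparr>"

definition cshift_map :: "('o, 'm, 'z) add_cat_scheme \<Rightarrow> ('o, 'm) cmap \<Rightarrow> ('o, 'm) cmap" where
  "cshift_map A = (\<lambda>(X, Y, f). (cshift A X, cshift A Y, \<lambda>n. f (n + 1)))"

text \<open>\<open>M\<close> is a mapping cone of \<open>f\<close>: degreewise \<open>M\<^sup>n\<close> is a direct sum of \<open>X\<^sup>n\<^sup>+\<^sup>1\<close> and \<open>Y\<^sup>n\<close>, with
  differential \<open>(x, y) \<mapsto> (- d x, f x + d y)\<close>. Direct sums in \<open>A\<close> are not chosen, so the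
  injections \<open>i\<close>, \<open>j\<close> and the projections \<open>p\<close>, \<open>q\<close> are part of the data.\<close>

definition mapping_cone ::
  "('o, 'm, 'z) add_cat_scheme \<Rightarrow> ('o, 'm) cmap \<Rightarrow> ('o, 'm) cochain \<Rightarrow>
   (int \<Rightarrow> 'm) \<Rightarrow> (int \<Rightarrow> 'm) \<Rightarrow> (int \<Rightarrow> 'm) \<Rightarrow> (int \<Rightarrow> 'm) \<Rightarrow> bool" where
  "mapping_cone A = (\<lambda>(X, Y, f) M i j p q.
     (\<forall>n. biproduct A (cob X (n + 1)) (cob Y n) (cob M n) (i n) (j n) (p n) (q n)) \<and>
     (\<forall>n. cdiff M n =
        Add A (Cmp A (i (n + 1)) (Cmp A (Neg A (cdiff X (n + 1))) (p n)))
       (Add A (Cmp A (j (n + 1)) (Cmp A (f (n + 1)) (p n)))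
              (Cmp A (j (n + 1)) (Cmp A (cdiff Y n) (q n))))))"

section \<open>Quotients by congruences and localisation\<close>

text \<open>The quotient of \<open>C\<close> by a congruence \<open>r\<close>, that is, an equivalence relation on \<open>Mor C\<close> that
  relates only parallel morphisms and is compatible with composition.\<close>

definition rep :: "'m set \<Rightarrow> 'm" where
  "rep E = (SOME f. f \<in> E)"

definition quot_cat ::
  "('o, 'm, 'z) cat_scheme \<Rightarrow> ('m \<times> 'm) set \<Rightarrow> ('o, 'm set) cat" where
  "quot_cat C r =
    \<lparr>Ob = Ob C,
     Mor = Mor C // r,
     Src = (\<lambda>E. Src C (rep E)),
     Tgt = (\<lambda>E. Tgt C (rep E)),
     Idt = (\<lambda>X. r `` {Idt C X}),
     Cmp = (\<lambda>E D. r `` {Cmp C (rep E) (rep D)})\<rparr>"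

text \<open>The localisation of \<open>C\<close> at \<open>S\<close>. A zigzag lists its steps in the order
  in which they are traversed; \<open>Bwd s\<close> stands for the formal inverse of \<open>s\<close>.\<close>

datatype 'm zz_step = Fwd 'm | Bwd 'm

type_synonym ('o, 'm) zz = "'o \<times> 'o \<times> 'm zz_step list"

inductive zz_path ::
  "('o, 'm, 'z) cat_scheme \<Rightarrow> 'm set \<Rightarrow> 'o \<Rightarrow> 'o \<Rightarrow> 'm zz_step list \<Rightarrow> bool"
  for C S where
  Nil: "X \<in> Ob C \<Longrightarrow> zz_path C S X X []"
| Fwd: "f \<in> Hom C X Y \<Longrightarrow> zz_path C S Y Z p \<Longrightarrow> zz_path C S X Z (Fwd f # p)"
| Bwd: "s \<in> Hom C Y X \<Longrightarrow> s \<in> S \<Longrightarrow> zz_path C S Y Z p \<Longrightarrow> zz_path C S X Z (Bwd s # p)"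

definition zz_cat :: "('o, 'm, 'z) cat_scheme \<Rightarrow> 'm set \<Rightarrow> ('o, ('o, 'm) zz) cat" where
  "zz_cat C S =
    \<lparr>Ob = Ob C,
     Mor = {(X, Y, p). zz_path C S X Y p},
     Src = (\<lambda>(X, Y, p). X),
     Tgt = (\<lambda>(X, Y, p). Y),
     Idt = (\<lambda>X. (X, X, [])),
     Cmp = (\<lambda>(Y', Z, q) (X, Y, p). (X, Z, p @ q))\<rparr>"

definition zz_fwd :: "('o, 'm, 'z) cat_scheme \<Rightarrow> 'm \<Rightarrow> ('o, 'm) zz" where
  "zz_fwd C f = (Src C f, Tgt C f, [Fwd f])"

definition zz_bwd :: "('o, 'm, 'z) cat_scheme \<Rightarrow> 'm \<Rightarrow> ('o, 'm) zz" where
  "zz_bwd C s = (Tgt C s, Src C s, [Bwd s])"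

text \<open>The least congruence making \<open>zz_fwd\<close> functorial and \<open>zz_bwd s\<close> inverse to \<open>zz_fwd s\<close> for
  \<open>s\<close> in \<open>S\<close>.\<close>

inductive_set zz_cong ::
  "('o, 'm, 'z) cat_scheme \<Rightarrow> 'm set \<Rightarrow> (('o, 'm) zz \<times> ('o, 'm) zz) set"
  for C S where
  refl: "a \<in> Mor (zz_cat C S) \<Longrightarrow> (a, a) \<in> zz_cong C S"
| sym: "(a, b) \<in> zz_cong C S \<Longrightarrow> (b, a) \<in> zz_cong C S"
| trans: "(a, b) \<in> zz_cong C S \<Longrightarrow> (b, c) \<in> zz_cong C S \<Longrightarrow> (a, c) \<in> zz_cong C S"
| Cmp: "(a, a') \<in> zz_cong C S \<Longrightarrow> (b, b') \<in> zz_cong C S \<Longrightarrow>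
    Tgt (zz_cat C S) a = Src (zz_cat C S) b \<Longrightarrow>
    (Cmp (zz_cat C S) b a, Cmp (zz_cat C S) b' a') \<in> zz_cong C S"
| fwd_Idt: "X \<in> Ob C \<Longrightarrow> (zz_fwd C (Idt C X), Idt (zz_cat C S) X) \<in> zz_cong C S"
| fwd_Cmp: "f \<in> Hom C X Y \<Longrightarrow> g \<in> Hom C Y Z \<Longrightarrow>
    (zz_fwd C (Cmp C g f), Cmp (zz_cat C S) (zz_fwd C g) (zz_fwd C f)) \<in> zz_cong C S"
| bwd_fwd: "s \<in> Hom C X Y \<Longrightarrow> s \<in> S \<Longrightarrow>
    (Cmp (zz_cat C S) (zz_bwd C s) (zz_fwd C s), Idt (zz_cat C S) X) \<in> zz_cong C S"
| fwd_bwd: "s \<in> Hom C X Y \<Longrightarrow> s \<in> S \<Longrightarrow>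
    (Cmp (zz_cat C S) (zz_fwd C s) (zz_bwd C s), Idt (zz_cat C S) Y) \<in> zz_cong C S"

definition localisation ::
  "('o, 'm, 'z) cat_scheme \<Rightarrow> 'm set \<Rightarrow> ('o, ('o, 'm) zz set) cat" where
  "localisation C S = quot_cat (zz_cat C S) (zz_cong C S)"

definition loc_mor :: "('o, 'm, 'z) cat_scheme \<Rightarrow> 'm set \<Rightarrow> 'm \<Rightarrow> ('o, 'm) zz set" where
  "loc_mor C S f = zz_cong C S `` {zz_fwd C f}"

section \<open>Distinguished triangles and Verdier localisation\<close>

text \<open>A category with a shift functor \<open>ShOb\<close>, \<open>ShMor\<close>, to which a class of distinguished
  triangles \<open>(u, v, w)\<close>, \<open>w\<close> ending in the shift of the source of \<open>u\<close>, is then added.\<close>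

record ('o, 'm) shift_cat = "('o, 'm) cat" +
  ShOb :: "'o \<Rightarrow> 'o"
  ShMor :: "'m \<Rightarrow> 'm"

record ('o, 'm) tri_cat = "('o, 'm) shift_cat" +
  Dist :: "('m \<times> 'm \<times> 'm) set"

definition triangle :: "('o, 'm, 'z) shift_cat_scheme \<Rightarrow> 'm \<times> 'm \<times> 'm \<Rightarrow> bool" where
  "triangle C = (\<lambda>(u, v, w). u \<in> Mor C \<and> v \<in> Mor C \<and> w \<in> Mor C \<and>
     Src C v = Tgt C u \<and> Src C w = Tgt C v \<and> Tgt C w = ShOb C (Src C u))"

definition triangle_iso ::
  "('o, 'm, 'z) shift_cat_scheme \<Rightarrow> 'm \<times> 'm \<times> 'm \<Rightarrow> 'm \<times> 'm \<times> 'm \<Rightarrow> bool" where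
  "triangle_iso C = (\<lambda>(u, v, w) (u', v', w').
     triangle C (u, v, w) \<and> triangle C (u', v', w') \<and>
     (\<exists>a b c. is_iso C a \<and> is_iso C b \<and> is_iso C c \<and>
        a \<in> Hom C (Src C u) (Src C u') \<and> b \<in> Hom C (Src C v) (Src C v') \<and>
        c \<in> Hom C (Src C w) (Src C w') \<and>
        Cmp C b u = Cmp C u' a \<and> Cmp C c v = Cmp C v' b \<and>
        Cmp C (ShMor C a) w = Cmp C w' c))"

definition with_triangles ::
  "('o, 'm) shift_cat \<Rightarrow> ('m \<times> 'm \<times> 'm) set \<Rightarrow> ('o, 'm) tri_cat" where
  "with_triangles C T =
     shift_cat.extend C (tri_cat.fields {t. \<exists>t' \<in> T. triangle_iso C t' t})"

definition K_mor :: "('o, 'm, 'z) add_cat_scheme \<Rightarrow> ('o, 'm) cmap \<Rightarrow> ('o, 'm) cmap set" where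
  "K_mor A f = homotopy A `` {f}"

definition K_shift_cat ::
  "('o, 'm, 'z) add_cat_scheme \<Rightarrow> (('o, 'm) cochain, ('o, 'm) cmap set) shift_cat" where
  "K_shift_cat A =
     cat.extend (quot_cat (Ch A) (homotopy A))
       (shift_cat.fields (cshift A) (\<lambda>E. K_mor A (cshift_map A (rep E))))"

definition cone_triangles ::
  "('o, 'm, 'z) add_cat_scheme \<Rightarrow>
   (('o, 'm) cmap set \<times> ('o, 'm) cmap set \<times> ('o, 'm) cmap set) set" where
  "cone_triangles A =
     {(K_mor A (X, Y, f), K_mor A (Y, M, j), K_mor A (M, cshift A X, p)) | X Y f M i j p q.
        (X, Y, f) \<in> Mor (Ch A) \<and> mapping_cone A (X, Y, f) M i j p q}"

definition K ::
  "('o, 'm, 'z) add_cat_scheme \<Rightarrow> (('o, 'm) cochain, ('o, 'm) cmap set) tri_cat" where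
  "K A = with_triangles (K_shift_cat A) (cone_triangles A)"

text \<open>For a triangulated subcategory of \<open>T\<close> with object class \<open>N\<close>, the Verdier localisation is
  the localisation at the morphisms whose cone lies in \<open>N\<close>; its triangles are those isomorphic to
  the image of a distinguished triangle of \<open>T\<close>. The shift acts on zigzags stepwise.\<close>

definition cone_in :: "('o, 'm, 'z) tri_cat_scheme \<Rightarrow> 'o set \<Rightarrow> 'm set" where
  "cone_in T N = {s. \<exists>v w. (s, v, w) \<in> Dist T \<and> Tgt T v \<in> N}"

definition zz_shift ::
  "('o, 'm, 'z) shift_cat_scheme \<Rightarrow> ('o, 'm) zz \<Rightarrow> ('o, 'm) zz" where
  "zz_shift C = (\<lambda>(X, Y, p). (ShOb C X, ShOb C Y, map (map_zz_step (ShMor C)) p))"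

definition verdier_mor ::
  "('o, 'm, 'z) tri_cat_scheme \<Rightarrow> 'o set \<Rightarrow> 'm \<Rightarrow> ('o, 'm) zz set" where
  "verdier_mor T N = loc_mor T (cone_in T N)"

definition verdier_shift_cat ::
  "('o, 'm, 'z) tri_cat_scheme \<Rightarrow> 'o set \<Rightarrow> ('o, ('o, 'm) zz set) shift_cat" where
  "verdier_shift_cat T N =
     cat.extend (localisation T (cone_in T N))
       (shift_cat.fields (ShOb T) (\<lambda>E. zz_cong T (cone_in T N) `` {zz_shift T (rep E)}))"

definition verdier_quotient ::
  "('o, 'm, 'z) tri_cat_scheme \<Rightarrow> 'o set \<Rightarrow> ('o, ('o, 'm) zz set) tri_cat" where
  "verdier_quotient T N =
     with_triangles (verdier_shift_cat T N)
       {(verdier_mor T N u, verdier_mor T N v, verdier_mor T N w) | u v w. (u, v, w) \<in> Dist T}"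

definition F_kernel ::
  "('o, 'm, 'y) add_cat_scheme \<Rightarrow> ('p, 'n, 'z) add_cat_scheme \<Rightarrow> ('o, 'm, 'p, 'n) fnctr \<Rightarrow>
   ('o, 'm) cochain set" where
  "F_kernel A B F = {S \<in> Ob (K A). contractible B (FOb (Ch_fnctr F) S)}"

definition D_F ::
  "('o, 'm, 'y) add_cat_scheme \<Rightarrow> ('p, 'n, 'z) add_cat_scheme \<Rightarrow> ('o, 'm, 'p, 'n) fnctr \<Rightarrow>
   (('o, 'm) cochain, (('o, 'm) cochain, ('o, 'm) cmap set) zz set) tri_cat" where
  "D_F A B F = verdier_quotient (K A) (F_kernel A B F)"

definition D_F_mor ::
  "('o, 'm, 'y) add_cat_scheme \<Rightarrow> ('p, 'n, 'z) add_cat_scheme \<Rightarrow> ('o, 'm, 'p, 'n) fnctr \<Rightarrow>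
   ('o, 'm) cmap \<Rightarrow> (('o, 'm) cochain, ('o, 'm) cmap set) zz set" where
  "D_F_mor A B F f = verdier_mor (K A) (F_kernel A B F) (K_mor A f)"

end

theory Submission
  imports Defs
begin

text \<open>
  Write \<open>u: X \<rightarrow> Y\<close> and \<open>v: Y \<rightarrow> Z\<close> for the two given maps. Let \<open>M\<close> be the cone of \<open>u\<close>, with inclusion
  \<open>j: Y \<rightarrow> M\<close> and projection \<open>p: M \<rightarrow> X[1]\<close>. As \<open>v u = 0\<close>, the map \<open>v\<close> extends by zero to a map of
  complexes \<open>\<phi>: M \<rightarrow> Z\<close> with \<open>\<phi> j = v\<close>. The functor \<open>F\<close> takes cones to cones, and after applying it
  the sequence splits, so that an explicit formula contracts the cone of \<open>F \<phi>\<close>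
  (\<open>contractible_comparison_cone\<close>). Hence \<open>\<phi>\<close> has its cone in the kernel of \<open>F\<close> and becomes
  invertible in the localisation, where the triangle \<open>(u, j, p)\<close> is isomorphic to \<open>(u, v, h)\<close> with
  \<open>h\<close> essentially \<open>p \<phi>\<^sup>-\<^sup>1\<close>.

  Since the shift of the localisation is defined through chosen representatives of classes of
  zigzags, one has to know that shifting a zigzag gives a zigzag, that is, that the class of
  inverted maps is closed under the shift (\<open>cone_in_kernel_ShMor\<close>). This rests on the
  isomorphism between the cone of \<open>f[1]\<close> and the shift of the cone of \<open>f\<close>
  (\<open>contractible_cone_cshift\<close>) and on the invariance of the kernel of \<open>F\<close> under isomorphism in
  the homotopy category (\<open>F_kernel_iso\<close>).

  Computations in a preadditive category are done by rewriting, with the side conditions on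
  sources and targets phrased through \<open>Mor\<close>, \<open>Src\<close> and \<open>Tgt\<close> rather than \<open>Hom\<close>, so that the
  simplifier can solve them.\<close>

section \<open>Composition and addition of morphisms\<close>

lemma in_Hom_iff: "f \<in> Hom C X Y \<longleftrightarrow> f \<in> Mor C \<and> Src C f = X \<and> Tgt C f = Y"
  by (auto simp: Hom_def)

context category
begin

lemma Cmp_in_Mor [simp]:
  assumes "f \<in> Mor C" "g \<in> Mor C" "Src C g = Tgt C f"
  shows "g \<odot> f \<in> Mor C" "Src C (g \<odot> f) = Src C f" "Tgt C (g \<odot> f) = Tgt C g"
  using Cmp_Hom[of f "Src C f" "Tgt C f" g "Tgt C g"] assms by (auto simp: in_Hom_iff)

lemma Idt_in_Mor [simp]:
  assumes "X \<in> Ob C"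
  shows "Idt C X \<in> Mor C" "Src C (Idt C X) = X" "Tgt C (Idt C X) = X"
  using Idt_Hom[OF assms] by (auto simp: in_Hom_iff)

lemma Cmp_Idt_right [simp]: "f \<in> Mor C \<Longrightarrow> Src C f = X \<Longrightarrow> f \<odot> Idt C X = f"
  using Cmp_Idt[of f X "Tgt C f"] by (auto simp: in_Hom_iff)

lemma Cmp_Idt_left [simp]: "f \<in> Mor C \<Longrightarrow> Tgt C f = Y \<Longrightarrow> Idt C Y \<odot> f = f"
  using Idt_Cmp[of f "Src C f" Y] by (auto simp: in_Hom_iff)

lemma Cmp_assoc_Mor [simp]:
  assumes "f \<in> Mor C" "g \<in> Mor C" "h \<in> Mor C" "Src C g = Tgt C f" "Src C h = Tgt C g"
  shows "(h \<odot> g) \<odot> f = h \<odot> (g \<odot> f)"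
  using Cmp_assoc[of f "Src C f" "Tgt C f" g "Tgt C g" h "Tgt C h"] assms
  by (auto simp: in_Hom_iff)

text \<open>Together with associativity as a rewrite rule to the right, this lets an equation between
  composites be used inside a longer composite.\<close>

lemma Cmp_eq_extend:
  assumes "a \<odot> b = c" "a \<in> Mor C" "b \<in> Mor C" "Src C a = Tgt C b" "x \<in> Mor C" "Src C b = Tgt C x"
  shows "a \<odot> (b \<odot> x) = c \<odot> x"
  using Cmp_assoc_Mor[of x b a] assms by simp

lemma is_isoI:
  assumes "f \<in> Hom C X Y" "g \<in> Hom C Y X" "g \<odot> f = Idt C X" "f \<odot> g = Idt C Y"
  shows "is_iso C f"
  using assms by (auto simp: is_iso_def in_Hom_iff)

lemma is_isoE:
  assumes "is_iso C f" "f \<in> Hom C X Y"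
  obtains g where "g \<in> Hom C Y X" "g \<odot> f = Idt C X" "f \<odot> g = Idt C Y"
  using assms by (auto simp: is_iso_def in_Hom_iff)

lemma is_iso_Idt: "X \<in> Ob C \<Longrightarrow> is_iso C (Idt C X)"
  by (rule is_isoI[of _ X X "Idt C X"]) (auto simp: in_Hom_iff)

end

context preadditive_category
begin

lemma Zer_in_Mor [simp]:
  assumes "X \<in> Ob C" "Y \<in> Ob C"
  shows "Zer C X Y \<in> Mor C" "Src C (Zer C X Y) = X" "Tgt C (Zer C X Y) = Y"
proof -
  interpret G: comm_group "Hom_group C X Y" using Hom_comm_group assms by blast
  have "Zer C X Y \<in> Hom C X Y" using G.one_closed by (simp add: Hom_group_def)
  then show "Zer C X Y \<in> Mor C" "Src C (Zer C X Y) = X" "Tgt C (Zer C X Y) = Y"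
    by (auto simp: in_Hom_iff)
qed

lemma Add_in_Mor [simp]:
  assumes "f \<in> Mor C" "g \<in> Mor C" "Src C g = Src C f" "Tgt C g = Tgt C f"
  shows "Add C f g \<in> Mor C" "Src C (Add C f g) = Src C f" "Tgt C (Add C f g) = Tgt C f"
proof -
  interpret G: comm_group "Hom_group C (Src C f) (Tgt C f)"
    using Hom_comm_group assms Src_Ob Tgt_Ob by blast
  have "Add C f g \<in> Hom C (Src C f) (Tgt C f)"
    using G.m_closed[of f g] assms by (simp add: Hom_group_def in_Hom_iff)
  then show "Add C f g \<in> Mor C" "Src C (Add C f g) = Src C f" "Tgt C (Add C f g) = Tgt C f"
    by (auto simp: in_Hom_iff)
qed

lemma Neg_in_Mor [simp]:
  assumes "f \<in> Mor C"
  shows "Neg C f \<in> Mor C" "Src C (Neg C f) = Src C f" "Tgt C (Neg C f) = Tgt C f"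
proof -
  interpret G: comm_group "Hom_group C (Src C f) (Tgt C f)"
    using Hom_comm_group assms Src_Ob Tgt_Ob by blast
  have "Neg C f \<in> Hom C (Src C f) (Tgt C f)"
    using G.inv_closed[of f] assms by (simp add: Hom_group_def in_Hom_iff Neg_def)
  then show "Neg C f \<in> Mor C" "Src C (Neg C f) = Src C f" "Tgt C (Neg C f) = Tgt C f"
    by (auto simp: in_Hom_iff)
qed

lemma Add_assoc:
  assumes "f \<in> Mor C" "g \<in> Mor C" "h \<in> Mor C" "Src C g = Src C f" "Tgt C g = Tgt C f"
    "Src C h = Src C f" "Tgt C h = Tgt C f"
  shows "Add C (Add C f g) h = Add C f (Add C g h)"
proof -
  interpret G: comm_group "Hom_group C (Src C f) (Tgt C f)"
    using Hom_comm_group assms Src_Ob Tgt_Ob by blast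
  show ?thesis using G.m_assoc[of f g h] assms by (simp add: Hom_group_def in_Hom_iff)
qed

lemma Add_commute:
  assumes "f \<in> Mor C" "g \<in> Mor C" "Src C g = Src C f" "Tgt C g = Tgt C f"
  shows "Add C f g = Add C g f"
proof -
  interpret G: comm_group "Hom_group C (Src C f) (Tgt C f)"
    using Hom_comm_group assms Src_Ob Tgt_Ob by blast
  show ?thesis using G.m_comm[of f g] assms by (simp add: Hom_group_def in_Hom_iff)
qed

lemma Add_left_commute:
  assumes "f \<in> Mor C" "g \<in> Mor C" "h \<in> Mor C" "Src C g = Src C f" "Tgt C g = Tgt C f"
    "Src C h = Src C f" "Tgt C h = Tgt C f"
  shows "Add C f (Add C g h) = Add C g (Add C f h)"
  using Add_assoc[of f g h] Add_assoc[of g f h] Add_commute[of f g] assms by simp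

lemmas Add_ac = Add_assoc Add_commute Add_left_commute

lemma Add_Zer_right [simp]:
  assumes "f \<in> Mor C" "Src C f = X" "Tgt C f = Y"
  shows "Add C f (Zer C X Y) = f"
proof -
  interpret G: comm_group "Hom_group C X Y"
    using Hom_comm_group assms Src_Ob Tgt_Ob by blast
  show ?thesis using G.r_one[of f] assms by (simp add: Hom_group_def in_Hom_iff)
qed

lemma Add_Zer_left [simp]:
  assumes "f \<in> Mor C" "Src C f = X" "Tgt C f = Y"
  shows "Add C (Zer C X Y) f = f"
  using Add_commute[of "Zer C X Y" f] assms Src_Ob[of f] Tgt_Ob[of f] by simp

lemma Add_Neg [simp]:
  assumes "f \<in> Mor C"
  shows "Add C f (Neg C f) = Zer C (Src C f) (Tgt C f)"
proof -
  interpret G: comm_group "Hom_group C (Src C f) (Tgt C f)"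
    using Hom_comm_group assms Src_Ob Tgt_Ob by blast
  show ?thesis using G.r_inv[of f] assms by (simp add: Hom_group_def in_Hom_iff Neg_def)
qed

lemma Neg_Add_self [simp]: "f \<in> Mor C \<Longrightarrow> Add C (Neg C f) f = Zer C (Src C f) (Tgt C f)"
  using Add_commute[of f "Neg C f"] by simp

lemma Add_Neg_cancel [simp]:
  assumes "f \<in> Mor C" "g \<in> Mor C" "Src C g = Src C f" "Tgt C g = Tgt C f"
  shows "Add C f (Add C (Neg C f) g) = g" "Add C (Neg C f) (Add C f g) = g"
  using Add_assoc[of f "Neg C f" g] Add_assoc[of "Neg C f" f g] assms by simp_all

lemma Add_left_cancel:
  assumes "Add C h f = Add C h g" "f \<in> Mor C" "g \<in> Mor C" "h \<in> Mor C"
    "Src C f = Src C h" "Tgt C f = Tgt C h" "Src C g = Src C h" "Tgt C g = Tgt C h"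
  shows "f = g"
proof -
  have "f = Add C (Neg C h) (Add C h f)"
    by (rule Add_Neg_cancel(2)[symmetric]) (use assms in auto)
  also have "\<dots> = Add C (Neg C h) (Add C h g)"
    by (simp only: assms(1))
  also have "\<dots> = g"
    by (rule Add_Neg_cancel(2)) (use assms in auto)
  finally show ?thesis .
qed

lemma Neg_unique:
  assumes "Add C f g = Zer C (Src C f) (Tgt C f)" "f \<in> Mor C" "g \<in> Mor C"
    "Src C g = Src C f" "Tgt C g = Tgt C f"
  shows "g = Neg C f"
  by (rule Add_left_cancel[of f]) (use assms in auto)

lemma Neg_Neg [simp]: "f \<in> Mor C \<Longrightarrow> Neg C (Neg C f) = f"
  by (rule Neg_unique[symmetric]) auto

lemma Neg_Add [simp]:
  assumes "f \<in> Mor C" "g \<in> Mor C" "Src C g = Src C f" "Tgt C g = Tgt C f"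
  shows "Neg C (Add C f g) = Add C (Neg C f) (Neg C g)"
proof (rule Neg_unique[symmetric])
  have "Add C (Neg C f) (Neg C g) = Add C (Neg C g) (Neg C f)"
    using Add_commute[of "Neg C f" "Neg C g"] assms by simp
  then show "Add C (Add C f g) (Add C (Neg C f) (Neg C g)) = Zer C (Src C (Add C f g)) (Tgt C (Add C f g))"
    using assms by (simp add: Add_assoc)
qed (use assms in auto)

lemma Neg_Zer [simp]: "X \<in> Ob C \<Longrightarrow> Y \<in> Ob C \<Longrightarrow> Neg C (Zer C X Y) = Zer C X Y"
  by (rule Neg_unique[symmetric]) auto

lemma Cmp_Add_right [simp]:
  assumes "f \<in> Mor C" "f' \<in> Mor C" "g \<in> Mor C" "Src C f' = Src C f" "Tgt C f' = Tgt C f"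
    "Src C g = Tgt C f"
  shows "g \<odot> Add C f f' = Add C (g \<odot> f) (g \<odot> f')"
  using Cmp_Add[of f "Src C f" "Tgt C f" f' g "Tgt C g"] assms by (auto simp: in_Hom_iff)

lemma Cmp_Add_left [simp]:
  assumes "f \<in> Mor C" "g \<in> Mor C" "g' \<in> Mor C" "Src C g' = Src C g" "Tgt C g' = Tgt C g"
    "Src C g = Tgt C f"
  shows "Add C g g' \<odot> f = Add C (g \<odot> f) (g' \<odot> f)"
  using Add_Cmp[of f "Src C f" "Tgt C f" g "Tgt C g" g'] assms by (auto simp: in_Hom_iff)

lemma Add_idem_Zer:
  assumes "Add C f f = f" "f \<in> Mor C"
  shows "f = Zer C (Src C f) (Tgt C f)"
  by (rule Add_left_cancel[of f]) (use assms Src_Ob[of f] Tgt_Ob[of f] in auto)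

lemma Cmp_Zer_right [simp]:
  assumes "g \<in> Mor C" "X \<in> Ob C" "Src C g = Y"
  shows "g \<odot> Zer C X Y = Zer C X (Tgt C g)"
proof -
  have Y: "Y \<in> Ob C" using assms Src_Ob by blast
  have "Add C (g \<odot> Zer C X Y) (g \<odot> Zer C X Y) = g \<odot> Zer C X Y"
    using Cmp_Add_right[of "Zer C X Y" "Zer C X Y" g] assms Y by simp
  then have "g \<odot> Zer C X Y = Zer C (Src C (g \<odot> Zer C X Y)) (Tgt C (g \<odot> Zer C X Y))"
    by (rule Add_idem_Zer) (use assms Y in auto)
  also have "\<dots> = Zer C X (Tgt C g)" using assms Y by simp
  finally show ?thesis .
qed

lemma Cmp_Zer_left [simp]:
  assumes "f \<in> Mor C" "Z \<in> Ob C" "Tgt C f = Y"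
  shows "Zer C Y Z \<odot> f = Zer C (Src C f) Z"
proof -
  have Y: "Y \<in> Ob C" using assms Tgt_Ob by blast
  have "Add C (Zer C Y Z \<odot> f) (Zer C Y Z \<odot> f) = Zer C Y Z \<odot> f"
    using Cmp_Add_left[of f "Zer C Y Z" "Zer C Y Z"] assms Y by simp
  then have "Zer C Y Z \<odot> f = Zer C (Src C (Zer C Y Z \<odot> f)) (Tgt C (Zer C Y Z \<odot> f))"
    by (rule Add_idem_Zer) (use assms Y in auto)
  also have "\<dots> = Zer C (Src C f) Z" using assms Y by simp
  finally show ?thesis .
qed

lemma Cmp_Neg_right [simp]:
  assumes "f \<in> Mor C" "g \<in> Mor C" "Src C g = Tgt C f"
  shows "g \<odot> Neg C f = Neg C (g \<odot> f)"
proof (rule Neg_unique)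
  have "Add C (g \<odot> f) (g \<odot> Neg C f) = g \<odot> Add C f (Neg C f)"
    by (rule Cmp_Add_right[symmetric]) (use assms in auto)
  then show "Add C (g \<odot> f) (g \<odot> Neg C f) = Zer C (Src C (g \<odot> f)) (Tgt C (g \<odot> f))"
    using assms Src_Ob[of f] by simp
qed (use assms in auto)

lemma Cmp_Neg_left [simp]:
  assumes "f \<in> Mor C" "g \<in> Mor C" "Src C g = Tgt C f"
  shows "Neg C g \<odot> f = Neg C (g \<odot> f)"
proof (rule Neg_unique)
  have "Add C (g \<odot> f) (Neg C g \<odot> f) = Add C g (Neg C g) \<odot> f"
    by (rule Cmp_Add_left[symmetric]) (use assms in auto)
  then show "Add C (g \<odot> f) (Neg C g \<odot> f) = Zer C (Src C (g \<odot> f)) (Tgt C (g \<odot> f))"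
    using assms Tgt_Ob[of g] by simp
qed (use assms in auto)

end

section \<open>Quotients by congruences\<close>

text \<open>The relation \<open>r\<close> is a congruence in the sense required by the quotient construction.\<close>

locale cat_congruence = category C
  for C :: "('o, 'm, 'z) cat_scheme" (structure) and r :: "('m \<times> 'm) set" +
  assumes equiv_r: "equiv (Mor C) r"
    and parallel_r: "(f, g) \<in> r \<Longrightarrow> Src C f = Src C g \<and> Tgt C f = Tgt C g"
    and Cmp_r: "(f, f') \<in> r \<Longrightarrow> (g, g') \<in> r \<Longrightarrow> Src C g = Tgt C f \<Longrightarrow> (g \<odot> f, g' \<odot> f') \<in> r"
begin

lemma refl_r: "f \<in> Mor C \<Longrightarrow> (f, f) \<in> r"
  using equiv_class_self[OF equiv_r] by auto

lemma rep_class: "f \<in> Mor C \<Longrightarrow> (f, rep (r `` {f})) \<in> r"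
  unfolding rep_def using refl_r someI[of "\<lambda>g. g \<in> r `` {f}" f] by auto

lemma class_eqI: "(f, g) \<in> r \<Longrightarrow> r `` {f} = r `` {g}"
  by (rule equiv_class_eq[OF equiv_r])

lemma Ob_quot [simp]: "Ob (quot_cat C r) = Ob C"
  by (simp add: quot_cat_def)

lemma Idt_quot: "Idt (quot_cat C r) X = r `` {Idt C X}"
  by (simp add: quot_cat_def)

lemma class_in_Mor [simp]:
  assumes "f \<in> Mor C"
  shows "r `` {f} \<in> Mor (quot_cat C r)"
    "Src (quot_cat C r) (r `` {f}) = Src C f" "Tgt (quot_cat C r) (r `` {f}) = Tgt C f"
  using assms rep_class[OF assms] parallel_r[OF rep_class[OF assms]]
  by (auto simp: quot_cat_def quotientI)

lemma Mor_quotE: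
  assumes "E \<in> Mor (quot_cat C r)"
  obtains f where "f \<in> Mor C" "E = r `` {f}" "Src (quot_cat C r) E = Src C f"
    "Tgt (quot_cat C r) E = Tgt C f"
proof -
  obtain f where "f \<in> Mor C" "E = r `` {f}"
    using assms by (auto simp: quot_cat_def elim: quotientE)
  then show thesis using that by simp
qed

lemma rep_in_Mor:
  assumes "E \<in> Mor (quot_cat C r)"
  shows "rep E \<in> Mor C" "r `` {rep E} = E" "Src C (rep E) = Src (quot_cat C r) E"
    "Tgt C (rep E) = Tgt (quot_cat C r) E"
proof -
  obtain f where f: "f \<in> Mor C" "E = r `` {f}" using assms by (rule Mor_quotE)
  have rel: "(f, rep E) \<in> r" using rep_class f by simp
  then show "rep E \<in> Mor C" using equiv_r by (auto simp: equiv_def)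
  show "r `` {rep E} = E" using class_eqI[OF rel] f by simp
  show "Src C (rep E) = Src (quot_cat C r) E" "Tgt C (rep E) = Tgt (quot_cat C r) E"
    using parallel_r[OF rel] f by auto
qed

lemma Cmp_class [simp]:
  assumes "f \<in> Mor C" "g \<in> Mor C" "Src C g = Tgt C f"
  shows "Cmp (quot_cat C r) (r `` {g}) (r `` {f}) = r `` {g \<odot> f}"
  using class_eqI[OF Cmp_r[OF rep_class rep_class]] assms by (simp add: quot_cat_def)

lemma category_quot: "category (quot_cat C r)"
proof
  fix E assume "E \<in> Mor (quot_cat C r)"
  then obtain f where "f \<in> Mor C" "E = r `` {f}" by (rule Mor_quotE)
  then show "Src (quot_cat C r) E \<in> Ob (quot_cat C r)" "Tgt (quot_cat C r) E \<in> Ob (quot_cat C r)"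
    by (simp_all add: Src_Ob Tgt_Ob)
next
  fix X assume "X \<in> Ob (quot_cat C r)"
  then show "Idt (quot_cat C r) X \<in> Hom (quot_cat C r) X X"
    by (simp add: Idt_quot in_Hom_iff)
next
  fix E D X Y Z assume "E \<in> Hom (quot_cat C r) X Y" "D \<in> Hom (quot_cat C r) Y Z"
  then show "Cmp (quot_cat C r) D E \<in> Hom (quot_cat C r) X Z"
    by (auto simp: in_Hom_iff elim!: Mor_quotE)
next
  fix E X Y assume "E \<in> Hom (quot_cat C r) X Y"
  then show "Cmp (quot_cat C r) E (Idt (quot_cat C r) X) = E"
    "Cmp (quot_cat C r) (Idt (quot_cat C r) Y) E = E"
    by (auto simp: in_Hom_iff Idt_quot Src_Ob Tgt_Ob elim!: Mor_quotE)
next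
  fix E D G W X Y Z
  assume "E \<in> Hom (quot_cat C r) W X" "D \<in> Hom (quot_cat C r) X Y" "G \<in> Hom (quot_cat C r) Y Z"
  then show "Cmp (quot_cat C r) (Cmp (quot_cat C r) G D) E =
      Cmp (quot_cat C r) G (Cmp (quot_cat C r) D E)"
    by (auto simp: in_Hom_iff elim!: Mor_quotE)
qed

end

section \<open>Complexes and homotopies\<close>

lemma Ch_simps [simp]:
  "X \<in> Ob (Ch A) \<longleftrightarrow> cochain_complex A X"
  "(X, Y, u) \<in> Mor (Ch A) \<longleftrightarrow> cochain_complex A X \<and> cochain_complex A Y \<and> cochain_map A X Y u"
  "Src (Ch A) (X, Y, u) = X" "Tgt (Ch A) (X, Y, u) = Y"
  "Idt (Ch A) X = (X, X, \<lambda>n. Idt A (cob X n))"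
  "Cmp (Ch A) (Y', Z, v) (X, Y, u) = (X, Z, \<lambda>n. Cmp A (v n) (u n))"
  "Zer (Ch A) X Y = (X, Y, \<lambda>n. Zer A (cob X n) (cob Y n))"
  by (simp_all add: Ch_def)

lemma Mor_Ch_iff:
  "f \<in> Mor (Ch A) \<longleftrightarrow> (\<exists>X Y u. f = (X, Y, u) \<and> cochain_complex A X \<and> cochain_complex A Y \<and>
    cochain_map A X Y u)"
  by (cases f) auto

lemma Hom_Ch_iff:
  "f \<in> Hom (Ch A) X Y \<longleftrightarrow> (\<exists>u. f = (X, Y, u) \<and> cochain_complex A X \<and> cochain_complex A Y \<and>
    cochain_map A X Y u)"
  by (cases f) (auto simp: in_Hom_iff)

text \<open>The boundary \<open>d s + s d\<close> of a family \<open>s\<close> of morphisms of degree \<open>- 1\<close>.\<close>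

definition htpy_boundary ::
  "('o, 'm, 'z) add_cat_scheme \<Rightarrow> ('o, 'm) cochain \<Rightarrow> ('o, 'm) cochain \<Rightarrow> (int \<Rightarrow> 'm) \<Rightarrow> int \<Rightarrow> 'm" where
  "htpy_boundary A X Y s n =
     Add A (Cmp A (cdiff Y (n - 1)) (s n)) (Cmp A (s (n + 1)) (cdiff X n))"

text \<open>The family \<open>s\<close> consists of morphisms from \<open>X\<^sup>n\<close> to \<open>Y\<^sup>n\<^sup>-\<^sup>1\<close>.\<close>

definition degree_minus_one ::
  "('o, 'm, 'z) add_cat_scheme \<Rightarrow> ('o, 'm) cochain \<Rightarrow> ('o, 'm) cochain \<Rightarrow> (int \<Rightarrow> 'm) \<Rightarrow> bool" where
  "degree_minus_one A X Y s \<longleftrightarrow> (\<forall>n. s n \<in> Hom A (cob X n) (cob Y (n - 1)))"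

lemma homotopy_iff:
  "((X, Y, u), (X', Y', v)) \<in> homotopy A \<longleftrightarrow>
     X' = X \<and> Y' = Y \<and> (X, Y, u) \<in> Mor (Ch A) \<and> (X, Y, v) \<in> Mor (Ch A) \<and>
     (\<exists>s. degree_minus_one A X Y s \<and> (\<forall>n. u n = Add A (v n) (htpy_boundary A X Y s n)))"
  by (simp add: homotopy_def htpy_boundary_def degree_minus_one_def)

lemma homotopyI:
  assumes "(X, Y, u) \<in> Mor (Ch A)" "(X, Y, v) \<in> Mor (Ch A)" "degree_minus_one A X Y s"
    "\<And>n. u n = Add A (v n) (htpy_boundary A X Y s n)"
  shows "((X, Y, u), (X, Y, v)) \<in> homotopy A"
  using assms by (auto simp: homotopy_iff)

lemma homotopyE:
  assumes "(f, g) \<in> homotopy A"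
  obtains X Y u v s where "f = (X, Y, u)" "g = (X, Y, v)" "cochain_complex A X"
    "cochain_complex A Y" "cochain_map A X Y u" "cochain_map A X Y v"
    "degree_minus_one A X Y s" "\<And>n. u n = Add A (v n) (htpy_boundary A X Y s n)"
proof -
  obtain X Y u X' Y' v where fg: "f = (X, Y, u)" "g = (X', Y', v)"
    using prod_cases3 by metis
  from assms show thesis unfolding fg homotopy_iff using that[of X Y u v] fg by auto
qed

lemma cshift_simps [simp]:
  "cob (cshift A X) n = cob X (n + 1)" "cdiff (cshift A X) n = Neg A (cdiff X (n + 1))"
  by (simp_all add: cshift_def)

lemma cshift_map_simp: "cshift_map A (X, Y, u) = (cshift A X, cshift A Y, \<lambda>n. u (n + 1))"
  by (simp add: cshift_map_def)

context preadditive_category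
begin

lemma complexD [simp]:
  assumes "cochain_complex C X"
  shows "cob X n \<in> Ob C" "cdiff X n \<in> Mor C" "Src C (cdiff X n) = cob X n"
    "Tgt C (cdiff X n) = cob X (n + 1)"
    "cdiff X (n + 1) \<odot> cdiff X n = Zer C (cob X n) (cob X (n + 2))"
  using assms by (auto simp: cochain_complex_def in_Hom_iff)

lemma complex_diff_diff:
  assumes "cochain_complex C X" "m = n + 1"
  shows "cdiff X m \<odot> cdiff X n = Zer C (cob X n) (cob X (m + 1))"
  using assms by (simp add: add.assoc)

lemma cochain_mapD:
  assumes "cochain_map C X Y u"
  shows "u n \<in> Mor C" "Src C (u n) = cob X n" "Tgt C (u n) = cob Y n"
    "u (n + 1) \<odot> cdiff X n = cdiff Y n \<odot> u n"
  using assms by (auto simp: cochain_map_def in_Hom_iff)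

text \<open>The equation \<open>u\<^sup>n\<^sup>+\<^sup>1 d\<^sup>n = d\<^sup>n u\<^sup>n\<close>, alone and inside a longer composite. The first index is a
  variable of its own, so that the equation also applies to the degrees \<open>n - 1\<close> and \<open>n\<close>.\<close>

lemma cochain_map_diff:
  assumes "cochain_map C X Y u" "m = n + 1"
  shows "u m \<odot> cdiff X n = cdiff Y n \<odot> u n"
  using cochain_mapD(4)[OF assms(1)] assms(2) by simp

lemma cochain_map_diff_Cmp:
  assumes "cochain_map C X Y u" "m = n + 1" "x \<in> Mor C" "Tgt C x = cob X n"
    "cochain_complex C X" "cochain_complex C Y"
  shows "u m \<odot> (cdiff X n \<odot> x) = cdiff Y n \<odot> (u n \<odot> x)"
  using Cmp_eq_extend[OF cochain_map_diff[OF assms(1,2)], of x] assms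
    cochain_mapD(1-3)[OF assms(1)] by simp

lemma degree_minus_oneD:
  assumes "degree_minus_one C X Y s"
  shows "s n \<in> Mor C" "Src C (s n) = cob X n" "Tgt C (s n) = cob Y (n - 1)"
  using assms by (auto simp: degree_minus_one_def in_Hom_iff)

lemma cochain_map_Idt: "cochain_complex C X \<Longrightarrow> cochain_map C X X (\<lambda>n. Idt C (cob X n))"
  by (auto simp: cochain_map_def in_Hom_iff)

lemma cochain_map_Zer:
  "cochain_complex C X \<Longrightarrow> cochain_complex C Y \<Longrightarrow>
    cochain_map C X Y (\<lambda>n. Zer C (cob X n) (cob Y n))"
  by (auto simp: cochain_map_def in_Hom_iff)

lemma cochain_map_Cmp:
  assumes "cochain_map C X Y u" "cochain_map C Y Z v"
    "cochain_complex C X" "cochain_complex C Y" "cochain_complex C Z"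
  shows "cochain_map C X Z (\<lambda>n. v n \<odot> u n)"
proof -
  note [simp] = cochain_mapD[OF assms(1)] cochain_mapD[OF assms(2)] assms(3-5)
  have "(v (n + 1) \<odot> u (n + 1)) \<odot> cdiff X n = cdiff Z n \<odot> (v n \<odot> u n)" for n
    using Cmp_eq_extend[OF cochain_mapD(4)[OF assms(2)], of n "u n"] by simp
  then show ?thesis by (auto simp: cochain_map_def in_Hom_iff)
qed

lemma category_Ch: "category (Ch C)"
proof
  fix f X Y assume "f \<in> Hom (Ch C) X Y"
  then obtain u where u: "f = (X, Y, u)" "cochain_complex C X" "cochain_complex C Y"
    "cochain_map C X Y u" by (auto simp: Hom_Ch_iff)
  note [simp] = u cochain_mapD[OF u(4)]
  show "Cmp (Ch C) f (Idt (Ch C) X) = f" "Cmp (Ch C) (Idt (Ch C) Y) f = f" by simp_all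
next
  fix f g X Y Z assume "f \<in> Hom (Ch C) X Y" "g \<in> Hom (Ch C) Y Z"
  then show "Cmp (Ch C) g f \<in> Hom (Ch C) X Z"
    by (auto simp: Hom_Ch_iff intro: cochain_map_Cmp)
next
  fix f g h W X Y Z
  assume "f \<in> Hom (Ch C) W X" "g \<in> Hom (Ch C) X Y" "h \<in> Hom (Ch C) Y Z"
  then show "Cmp (Ch C) (Cmp (Ch C) h g) f = Cmp (Ch C) h (Cmp (Ch C) g f)"
    by (auto simp: Hom_Ch_iff cochain_mapD)
qed (auto simp: Mor_Ch_iff in_Hom_iff cochain_map_Idt)

lemma htpy_boundary_in_Mor:
  assumes "degree_minus_one C X Y s" "cochain_complex C X" "cochain_complex C Y"
  shows "htpy_boundary C X Y s n \<in> Mor C" "Src C (htpy_boundary C X Y s n) = cob X n"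
    "Tgt C (htpy_boundary C X Y s n) = cob Y n"
  using assms degree_minus_oneD[OF assms(1)] by (auto simp: htpy_boundary_def)

lemma homotopy_refl:
  assumes "f \<in> Mor (Ch C)"
  shows "(f, f) \<in> homotopy C"
proof -
  obtain X Y u where u: "f = (X, Y, u)" "cochain_complex C X" "cochain_complex C Y"
    "cochain_map C X Y u" using assms by (auto simp: Mor_Ch_iff)
  note [simp] = u cochain_mapD[OF u(4)]
  show ?thesis unfolding u(1)
    by (rule homotopyI[where s = "\<lambda>n. Zer C (cob X n) (cob Y (n - 1))"])
      (auto simp: degree_minus_one_def in_Hom_iff htpy_boundary_def)
qed

lemma homotopy_sym:
  assumes "(f, g) \<in> homotopy C"
  shows "(g, f) \<in> homotopy C"
proof -
  obtain X Y u v s where fg: "f = (X, Y, u)" "g = (X, Y, v)" "cochain_complex C X"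
    "cochain_complex C Y" "cochain_map C X Y u" "cochain_map C X Y v"
    "degree_minus_one C X Y s" "\<And>n. u n = Add C (v n) (htpy_boundary C X Y s n)"
    using assms by (rule homotopyE) metis
  note [simp] = cochain_mapD[OF fg(6)] degree_minus_oneD[OF fg(7)]
    htpy_boundary_in_Mor[OF fg(7,3,4)] fg(3,4)
  have "htpy_boundary C X Y (\<lambda>n. Neg C (s n)) n = Neg C (htpy_boundary C X Y s n)" for n
    by (simp add: htpy_boundary_def)
  then show ?thesis unfolding fg(1,2) using fg
    by (intro homotopyI[where s = "\<lambda>n. Neg C (s n)"])
      (auto simp: degree_minus_one_def in_Hom_iff Add_assoc)
qed

lemma homotopy_trans:
  assumes "(f, g) \<in> homotopy C" "(g, h) \<in> homotopy C"
  shows "(f, h) \<in> homotopy C"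
proof -
  obtain X Y u v s where fg: "f = (X, Y, u)" "g = (X, Y, v)" "cochain_complex C X"
    "cochain_complex C Y" "cochain_map C X Y u" "cochain_map C X Y v"
    "degree_minus_one C X Y s" "\<And>n. u n = Add C (v n) (htpy_boundary C X Y s n)"
    using assms(1) by (rule homotopyE) metis
  obtain w t where gh: "h = (X, Y, w)" "cochain_map C X Y w"
    "degree_minus_one C X Y t" "\<And>n. v n = Add C (w n) (htpy_boundary C X Y t n)"
    using assms(2) fg(2) by (elim homotopyE) auto
  note [simp] = cochain_mapD[OF gh(2)] degree_minus_oneD[OF fg(7)] degree_minus_oneD[OF gh(3)]
    htpy_boundary_in_Mor[OF fg(7,3,4)] htpy_boundary_in_Mor[OF gh(3) fg(3,4)] fg(3,4)
  have "htpy_boundary C X Y (\<lambda>n. Add C (t n) (s n)) n =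
      Add C (htpy_boundary C X Y t n) (htpy_boundary C X Y s n)" for n
    by (simp add: htpy_boundary_def Add_ac)
  then show ?thesis unfolding fg(1,2) gh(1) using fg gh
    by (intro homotopyI[where s = "\<lambda>n. Add C (t n) (s n)"])
      (auto simp: degree_minus_one_def in_Hom_iff Add_assoc)
qed

lemma homotopy_Cmp_left:
  assumes "(f, f') \<in> homotopy C" "g \<in> Mor (Ch C)" "Src (Ch C) g = Tgt (Ch C) f"
  shows "(Cmp (Ch C) g f, Cmp (Ch C) g f') \<in> homotopy C"
proof -
  obtain X Y u v s where fg: "f = (X, Y, u)" "f' = (X, Y, v)" "cochain_complex C X"
    "cochain_complex C Y" "cochain_map C X Y u" "cochain_map C X Y v"
    "degree_minus_one C X Y s" "\<And>n. u n = Add C (v n) (htpy_boundary C X Y s n)"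
    using assms(1) by (rule homotopyE) metis
  obtain Z w where w: "g = (Y, Z, w)" "cochain_complex C Z" "cochain_map C Y Z w"
    using assms(2,3) fg(1) by (auto simp: Mor_Ch_iff)
  note [simp] = cochain_mapD(1-3)[OF fg(6)] degree_minus_oneD[OF fg(7)]
    htpy_boundary_in_Mor[OF fg(7,3,4)] fg(3,4) w(2) cochain_mapD(1-3)[OF w(3)]
  have "w n \<odot> htpy_boundary C X Y s n = htpy_boundary C X Z (\<lambda>n. w (n - 1) \<odot> s n) n" for n
    using Cmp_eq_extend[OF cochain_mapD(4)[OF w(3)], of "n - 1" "s n"]
    by (simp add: htpy_boundary_def)
  then have "w n \<odot> u n = Add C (w n \<odot> v n) (htpy_boundary C X Z (\<lambda>n. w (n - 1) \<odot> s n) n)" for n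
    by (simp add: fg(8))
  then show ?thesis unfolding fg(1,2) w(1) Ch_simps
    using fg(3) cochain_map_Cmp[OF fg(5) w(3)] cochain_map_Cmp[OF fg(6) w(3)]
    by (intro homotopyI[where s = "\<lambda>n. w (n - 1) \<odot> s n"])
      (auto simp: degree_minus_one_def in_Hom_iff)
qed

lemma homotopy_Cmp_right:
  assumes "(g, g') \<in> homotopy C" "f \<in> Mor (Ch C)" "Src (Ch C) g = Tgt (Ch C) f"
  shows "(Cmp (Ch C) g f, Cmp (Ch C) g' f) \<in> homotopy C"
proof -
  obtain X Y u v s where fg: "g = (X, Y, u)" "g' = (X, Y, v)" "cochain_complex C X"
    "cochain_complex C Y" "cochain_map C X Y u" "cochain_map C X Y v"
    "degree_minus_one C X Y s" "\<And>n. u n = Add C (v n) (htpy_boundary C X Y s n)"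
    using assms(1) by (rule homotopyE) metis
  obtain W w where w: "f = (W, X, w)" "cochain_complex C W" "cochain_map C W X w"
    using assms(2,3) fg(1) by (auto simp: Mor_Ch_iff)
  note [simp] = cochain_mapD(1-3)[OF fg(6)] degree_minus_oneD[OF fg(7)]
    htpy_boundary_in_Mor[OF fg(7,3,4)] fg(3,4) w(2) cochain_mapD[OF w(3)]
  have "htpy_boundary C X Y s n \<odot> w n = htpy_boundary C W Y (\<lambda>n. s n \<odot> w n) n" for n
    by (simp add: htpy_boundary_def)
  then have "u n \<odot> w n = Add C (v n \<odot> w n) (htpy_boundary C W Y (\<lambda>n. s n \<odot> w n) n)" for n
    by (simp add: fg(8))
  then show ?thesis unfolding fg(1,2) w(1) Ch_simps
    using fg(3) cochain_map_Cmp[OF w(3) fg(5)] cochain_map_Cmp[OF w(3) fg(6)]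
    by (intro homotopyI[where s = "\<lambda>n. s n \<odot> w n"])
      (auto simp: degree_minus_one_def in_Hom_iff)
qed

lemma congruence_homotopy: "cat_congruence (Ch C) (homotopy C)"
proof -
  interpret Ch: category "Ch C" by (rule category_Ch)
  show ?thesis
  proof
    show "equiv (Mor (Ch C)) (homotopy C)"
    proof (rule equivI)
      show "homotopy C \<subseteq> Mor (Ch C) \<times> Mor (Ch C)" by (auto elim!: homotopyE)
    qed (auto intro!: refl_onI symI transI intro: homotopy_refl homotopy_sym homotopy_trans)
  next
    fix f g assume "(f, g) \<in> homotopy C"
    then show "Src (Ch C) f = Src (Ch C) g \<and> Tgt (Ch C) f = Tgt (Ch C) g"
      by (auto elim!: homotopyE)
  next
    fix f f' g g' assume *: "(f, f') \<in> homotopy C" "(g, g') \<in> homotopy C"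
      "Src (Ch C) g = Tgt (Ch C) f"
    have "(Cmp (Ch C) g f, Cmp (Ch C) g f') \<in> homotopy C"
      by (rule homotopy_Cmp_left) (use * in \<open>auto elim!: homotopyE\<close>)
    moreover have "(Cmp (Ch C) g f', Cmp (Ch C) g' f') \<in> homotopy C"
      by (rule homotopy_Cmp_right) (use * in \<open>auto elim!: homotopyE\<close>)
    ultimately show "(Cmp (Ch C) g f, Cmp (Ch C) g' f') \<in> homotopy C"
      by (rule homotopy_trans)
  qed
qed

lemma complex_cshift:
  assumes "cochain_complex C X"
  shows "cochain_complex C (cshift C X)"
proof -
  have "cdiff X (2 + n) \<odot> cdiff X (n + 1) = Zer C (cob X (n + 1)) (cob X (3 + n))" for n
    using complex_diff_diff[OF assms, of "2 + n" "n + 1"] by (simp add: algebra_simps)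
  then show ?thesis
    unfolding cochain_complex_def[of C "cshift C X"]
    using assms by (auto simp: cshift_def in_Hom_iff)
qed

lemma cochain_map_cshift:
  assumes "cochain_map C X Y u" "cochain_complex C X" "cochain_complex C Y"
  shows "cochain_map C (cshift C X) (cshift C Y) (\<lambda>n. u (n + 1))"
  using assms cochain_mapD(1-3)[OF assms(1)] cochain_mapD(4)[OF assms(1), of "_ + 1"]
  by (auto simp: cochain_map_def cshift_def in_Hom_iff)

lemma cshift_map_in_Mor:
  assumes "f \<in> Mor (Ch C)"
  shows "cshift_map C f \<in> Mor (Ch C)" "Src (Ch C) (cshift_map C f) = cshift C (Src (Ch C) f)"
    "Tgt (Ch C) (cshift_map C f) = cshift C (Tgt (Ch C) f)"
  using assms by (auto simp: Mor_Ch_iff cshift_map_simp complex_cshift cochain_map_cshift)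

lemma homotopy_cshift_map:
  assumes "(f, g) \<in> homotopy C"
  shows "(cshift_map C f, cshift_map C g) \<in> homotopy C"
proof -
  obtain X Y u v s where fg: "f = (X, Y, u)" "g = (X, Y, v)" "cochain_complex C X"
    "cochain_complex C Y" "cochain_map C X Y u" "cochain_map C X Y v"
    "degree_minus_one C X Y s" "\<And>n. u n = Add C (v n) (htpy_boundary C X Y s n)"
    using assms by (rule homotopyE) metis
  note [simp] = cochain_mapD(1-3)[OF fg(6)] degree_minus_oneD[OF fg(7)]
    htpy_boundary_in_Mor[OF fg(7,3,4)] fg(3,4)
  \<comment> \<open>The shift changes the sign of the differential, hence that of the homotopy.\<close>
  have "htpy_boundary C (cshift C X) (cshift C Y) (\<lambda>n. Neg C (s (n + 1))) n =
      htpy_boundary C X Y s (n + 1)" for n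
    by (simp add: htpy_boundary_def cshift_def)
  then show ?thesis unfolding fg(1,2) cshift_map_simp
    using complex_cshift[OF fg(3)] complex_cshift[OF fg(4)] cochain_map_cshift[OF fg(5,3,4)]
      cochain_map_cshift[OF fg(6,3,4)] fg(8)[of "_ + 1"]
    by (intro homotopyI[where s = "\<lambda>n. Neg C (s (n + 1))"])
      (auto simp: degree_minus_one_def in_Hom_iff)
qed

end

section \<open>The homotopy category\<close>

lemma with_triangles_simps [simp]:
  "Ob (with_triangles C T) = Ob C" "Mor (with_triangles C T) = Mor C"
  "Src (with_triangles C T) = Src C" "Tgt (with_triangles C T) = Tgt C"
  "Idt (with_triangles C T) = Idt C" "Cmp (with_triangles C T) = Cmp C"
  "ShOb (with_triangles C T) = ShOb C" "ShMor (with_triangles C T) = ShMor C"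
  "Dist (with_triangles C T) = {t. \<exists>t' \<in> T. triangle_iso C t' t}"
  by (simp_all add: with_triangles_def shift_cat.extend_def tri_cat.fields_def)

lemma K_shift_cat_simps [simp]:
  "Ob (K_shift_cat A) = Ob (quot_cat (Ch A) (homotopy A))"
  "Mor (K_shift_cat A) = Mor (quot_cat (Ch A) (homotopy A))"
  "Src (K_shift_cat A) = Src (quot_cat (Ch A) (homotopy A))"
  "Tgt (K_shift_cat A) = Tgt (quot_cat (Ch A) (homotopy A))"
  "Idt (K_shift_cat A) = Idt (quot_cat (Ch A) (homotopy A))"
  "Cmp (K_shift_cat A) = Cmp (quot_cat (Ch A) (homotopy A))"
  "ShOb (K_shift_cat A) = cshift A"
  "ShMor (K_shift_cat A) E = K_mor A (cshift_map A (rep E))"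
  by (simp_all add: K_shift_cat_def cat.extend_def shift_cat.fields_def)

lemma K_simps:
  "Ob (K A) = Ob (quot_cat (Ch A) (homotopy A))"
  "Mor (K A) = Mor (quot_cat (Ch A) (homotopy A))"
  "Src (K A) = Src (quot_cat (Ch A) (homotopy A))"
  "Tgt (K A) = Tgt (quot_cat (Ch A) (homotopy A))"
  "Idt (K A) = Idt (quot_cat (Ch A) (homotopy A))"
  "Cmp (K A) = Cmp (quot_cat (Ch A) (homotopy A))"
  "ShOb (K A) = cshift A"
  "ShMor (K A) E = K_mor A (cshift_map A (rep E))"
  "Dist (K A) = {t. \<exists>t' \<in> cone_triangles A. triangle_iso (K_shift_cat A) t' t}"
  by (simp_all add: K_def)

text \<open>Being a category, or an isomorphism in one, depends only on the first six fields.\<close>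

lemma category_transfer:
  assumes "category C" "Ob D = Ob C" "Mor D = Mor C" "Src D = Src C" "Tgt D = Tgt C"
    "Idt D = Idt C" "Cmp D = Cmp C"
  shows "category D"
  using assms unfolding category_def Hom_def by simp

lemma is_iso_transfer:
  assumes "Mor D = Mor C" "Src D = Src C" "Tgt D = Tgt C" "Idt D = Idt C" "Cmp D = Cmp C"
  shows "is_iso D f = is_iso C f"
  using assms unfolding is_iso_def Hom_def by simp

lemma Hom_transfer:
  assumes "Mor D = Mor C" "Src D = Src C" "Tgt D = Tgt C"
  shows "Hom D X Y = Hom C X Y"
  using assms unfolding Hom_def by simp

lemma Hom_K_shift_cat: "Hom (K_shift_cat A) X Y = Hom (K A) X Y"
  by (rule Hom_transfer) (auto simp: K_simps)

lemma is_iso_K_shift_cat: "is_iso (K_shift_cat A) f = is_iso (K A) f"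
  by (rule is_iso_transfer) (auto simp: K_simps)

lemma triangle_iso_K_shift_cat: "triangle_iso (K_shift_cat A) t t' = triangle_iso (K A) t t'"
  by (simp add: triangle_iso_def triangle_def Hom_K_shift_cat is_iso_K_shift_cat K_simps)

lemma Dist_K: "Dist (K A) = {t. \<exists>t' \<in> cone_triangles A. triangle_iso (K A) t' t}"
  by (simp add: K_simps triangle_iso_K_shift_cat)

context preadditive_category
begin

lemma category_K: "category (K C)"
  by (rule category_transfer[OF cat_congruence.category_quot[OF congruence_homotopy]]) (simp_all add: K_simps)

lemma Ob_K: "X \<in> Ob (K C) \<longleftrightarrow> cochain_complex C X"
  using cat_congruence.Ob_quot[OF congruence_homotopy] by (simp add: K_simps)

lemma K_mor_in_Mor:
  assumes "f \<in> Mor (Ch C)"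
  shows "K_mor C f \<in> Mor (K C)" "Src (K C) (K_mor C f) = Src (Ch C) f"
    "Tgt (K C) (K_mor C f) = Tgt (Ch C) f"
  using cat_congruence.class_in_Mor[OF congruence_homotopy assms] by (simp_all add: K_mor_def K_simps)

lemma K_mor_Hom:
  "cochain_map C X Y u \<Longrightarrow> cochain_complex C X \<Longrightarrow> cochain_complex C Y \<Longrightarrow>
    K_mor C (X, Y, u) \<in> Hom (K C) X Y"
  using K_mor_in_Mor[of "(X, Y, u)"] by (simp add: in_Hom_iff)

lemma K_mor_eqI: "(f, g) \<in> homotopy C \<Longrightarrow> K_mor C f = K_mor C g"
  using cat_congruence.class_eqI[OF congruence_homotopy] by (simp add: K_mor_def K_simps)

lemma K_mor_eqD: "K_mor C f = K_mor C g \<Longrightarrow> g \<in> Mor (Ch C) \<Longrightarrow> (f, g) \<in> homotopy C"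
  unfolding K_mor_def using homotopy_refl[of g] by blast

lemma K_mor_Idt: "K_mor C (Idt (Ch C) X) = Idt (K C) X"
  using cat_congruence.Idt_quot[OF congruence_homotopy] by (simp add: K_mor_def K_simps)

lemma K_mor_Cmp:
  assumes "f \<in> Mor (Ch C)" "g \<in> Mor (Ch C)" "Src (Ch C) g = Tgt (Ch C) f"
  shows "Cmp (K C) (K_mor C g) (K_mor C f) = K_mor C (Cmp (Ch C) g f)"
  using cat_congruence.Cmp_class[OF congruence_homotopy assms] by (simp add: K_mor_def K_simps)

lemma Hom_K_E:
  assumes "E \<in> Hom (K C) X Y"
  obtains u where "E = K_mor C (X, Y, u)" "cochain_map C X Y u" "cochain_complex C X"
    "cochain_complex C Y"
proof -
  have "E \<in> Mor (quot_cat (Ch C) (homotopy C))" using assms by (simp add: in_Hom_iff K_simps)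
  then obtain f where "f \<in> Mor (Ch C)" "E = K_mor C f"
    by (rule cat_congruence.Mor_quotE[OF congruence_homotopy]) (auto simp: K_mor_def)
  then show thesis using that assms K_mor_in_Mor[of f] by (auto simp: Mor_Ch_iff in_Hom_iff)
qed

lemma ShMor_K_mor:
  assumes "f \<in> Mor (Ch C)"
  shows "ShMor (K C) (K_mor C f) = K_mor C (cshift_map C f)"
proof -
  have "(f, rep (K_mor C f)) \<in> homotopy C"
    using cat_congruence.rep_class[OF congruence_homotopy assms] by (simp add: K_mor_def K_simps)
  then show ?thesis using K_mor_eqI[OF homotopy_cshift_map] by (simp add: K_simps)
qed

lemma ShMor_K_Hom:
  assumes "E \<in> Hom (K C) X Y"
  shows "ShMor (K C) E \<in> Hom (K C) (cshift C X) (cshift C Y)"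
proof -
  obtain u where u: "E = K_mor C (X, Y, u)" "(X, Y, u) \<in> Mor (Ch C)"
    using assms by (rule Hom_K_E) auto
  show ?thesis
    using K_mor_in_Mor[OF cshift_map_in_Mor(1)[OF u(2)]] cshift_map_in_Mor[OF u(2)]
    unfolding u(1) ShMor_K_mor[OF u(2)] in_Hom_iff by simp
qed

lemma ShMor_K_Idt: "X \<in> Ob (K C) \<Longrightarrow> ShMor (K C) (Idt (K C) X) = Idt (K C) (cshift C X)"
  using ShMor_K_mor[of "Idt (Ch C) X"]
  by (simp add: K_mor_Idt[symmetric] Ob_K cochain_map_Idt cshift_map_simp)

lemma ShMor_K_Cmp:
  assumes "E \<in> Hom (K C) X Y" "D \<in> Hom (K C) Y Z"
  shows "ShMor (K C) (Cmp (K C) D E) = Cmp (K C) (ShMor (K C) D) (ShMor (K C) E)"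
proof -
  obtain u where u: "E = K_mor C (X, Y, u)" "cochain_map C X Y u" "cochain_complex C X"
    "cochain_complex C Y"
    using assms(1) by (rule Hom_K_E)
  obtain v where v: "D = K_mor C (Y, Z, v)" "cochain_map C Y Z v" "cochain_complex C Z"
    using assms(2) by (rule Hom_K_E)
  show ?thesis
    using u(2-) v(2-) cshift_map_in_Mor[of "(X, Y, u)"] cshift_map_in_Mor[of "(Y, Z, v)"]
    unfolding u(1) v(1)
    by (simp add: K_mor_Cmp ShMor_K_mor cshift_map_simp cochain_map_Cmp)
qed

lemma ShMor_K_iso:
  assumes "is_iso (K C) E" "E \<in> Hom (K C) X Y"
  shows "is_iso (K C) (ShMor (K C) E)"
proof -
  interpret K: category "K C" by (rule category_K)
  obtain D where D: "D \<in> Hom (K C) Y X" "Cmp (K C) D E = Idt (K C) X" "Cmp (K C) E D = Idt (K C) Y"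
    using K.is_isoE[OF assms] by metis
  have "X \<in> Ob (K C)" "Y \<in> Ob (K C)"
    using assms(2) K.Src_Ob K.Tgt_Ob by (auto simp: in_Hom_iff)
  then show ?thesis
    using ShMor_K_Cmp[OF assms(2) D(1)] ShMor_K_Cmp[OF D(1) assms(2)] D
    by (intro K.is_isoI[OF ShMor_K_Hom[OF assms(2)] ShMor_K_Hom[OF D(1)]])
      (simp_all add: ShMor_K_Idt)
qed

section \<open>Contractible complexes\<close>

lemma contractibleI:
  assumes "cochain_complex C X" "degree_minus_one C X X s"
    "\<And>n. htpy_boundary C X X s n = Idt C (cob X n)"
  shows "contractible C X"
  unfolding contractible_def Ch_simps
  using assms cochain_map_Idt cochain_map_Zer by (auto intro!: homotopyI[where s = s])

lemma homotopy_Zer_Cmp_left: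
  assumes "(f, Zer (Ch C) X Y) \<in> homotopy C" "g \<in> Hom (Ch C) Y Z"
  shows "(Cmp (Ch C) g f, Zer (Ch C) X Z) \<in> homotopy C"
proof -
  have "(Cmp (Ch C) g f, Cmp (Ch C) g (Zer (Ch C) X Y)) \<in> homotopy C"
    by (rule homotopy_Cmp_left) (use assms in \<open>auto simp: in_Hom_iff elim!: homotopyE\<close>)
  moreover have "Cmp (Ch C) g (Zer (Ch C) X Y) = Zer (Ch C) X Z"
    using assms by (auto simp: Hom_Ch_iff cochain_mapD elim!: homotopyE)
  ultimately show ?thesis by simp
qed

text \<open>A complex whose identity factors, up to homotopy, through a contractible complex is itself
  contractible.\<close>

lemma contractible_retract:
  assumes "contractible C Y" "f \<in> Hom (Ch C) X Y" "g \<in> Hom (Ch C) Y X"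
    "(Cmp (Ch C) g f, Idt (Ch C) X) \<in> homotopy C"
  shows "contractible C X"
proof -
  interpret Ch: category "Ch C" by (rule category_Ch)
  have f: "f \<in> Mor (Ch C)" "Src (Ch C) f = X" "Tgt (Ch C) f = Y" and X: "cochain_complex C X"
    and Y: "cochain_complex C Y"
    using assms(2) by (auto simp: Hom_Ch_iff)
  have "(Cmp (Ch C) (Idt (Ch C) Y) f, Cmp (Ch C) (Zer (Ch C) Y Y) f) \<in> homotopy C"
    using assms(1) f by (intro homotopy_Cmp_right) (auto simp: contractible_def)
  moreover have "Cmp (Ch C) (Idt (Ch C) Y) f = f"
    by (rule Ch.Cmp_Idt_left) (use f in auto)
  moreover have "Cmp (Ch C) (Zer (Ch C) Y Y) f = Zer (Ch C) X Y"
    using assms(2) by (auto simp: Hom_Ch_iff cochain_mapD)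
  ultimately have "(f, Zer (Ch C) X Y) \<in> homotopy C" by simp
  then have "(Cmp (Ch C) g f, Zer (Ch C) X X) \<in> homotopy C"
    using assms(3) by (rule homotopy_Zer_Cmp_left)
  then have "(Idt (Ch C) X, Zer (Ch C) X X) \<in> homotopy C"
    using assms(4) homotopy_sym homotopy_trans by blast
  then show ?thesis using X by (simp add: contractible_def)
qed

lemma contractible_cshift:
  assumes "contractible C X"
  shows "contractible C (cshift C X)"
  using homotopy_cshift_map[of "Idt (Ch C) X" "Zer (Ch C) X X"] assms complex_cshift
  by (simp add: contractible_def cshift_map_simp)

end

section \<open>Mapping cones\<close>

context preadditive_category
begin

lemma biproductD:
  assumes "biproduct C X Y M i j p q"
  shows "X \<in> Ob C" "Y \<in> Ob C" "M \<in> Ob C"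
    "i \<in> Mor C" "Src C i = X" "Tgt C i = M" "j \<in> Mor C" "Src C j = Y" "Tgt C j = M"
    "p \<in> Mor C" "Src C p = M" "Tgt C p = X" "q \<in> Mor C" "Src C q = M" "Tgt C q = Y"
    "p \<odot> i = Idt C X" "q \<odot> j = Idt C Y" "q \<odot> i = Zer C X Y" "p \<odot> j = Zer C Y X"
    "Add C (i \<odot> p) (j \<odot> q) = Idt C M"
  using assms by (auto simp: biproduct_def in_Hom_iff)

text \<open>Morphisms out of a direct sum are equal if they agree on both summands.\<close>

lemma biproduct_eqI:
  assumes "biproduct C X Y M i j p q" "f \<odot> i = g \<odot> i" "f \<odot> j = g \<odot> j"
    "f \<in> Mor C" "g \<in> Mor C" "Src C f = M" "Src C g = M" "Tgt C g = Tgt C f"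
  shows "f = g"
proof -
  note [simp] = biproductD(1-19)[OF assms(1)]
  have *: "h = Add C ((h \<odot> i) \<odot> p) ((h \<odot> j) \<odot> q)" if "h \<in> Mor C" "Src C h = M" for h
  proof -
    have "h \<odot> Add C (i \<odot> p) (j \<odot> q) = h"
      unfolding biproductD(20)[OF assms(1)] using that by simp
    then show ?thesis using that by simp
  qed
  show ?thesis
    using *[of f] *[of g] assms(2-) by metis
qed

end

text \<open>A map of complexes \<open>u\<close> together with a cone \<open>M\<close> of it. The differential of the cone is used
  through its composites with the injections and projections. Each rule comes also in a form for
  use inside a longer composite, and, where \<open>n + 1\<close> would occur on the left, with a second index
  \<open>m = n + 1\<close>.\<close>

locale cone = preadditive_category C
  for C :: "('o, 'm, 'z) add_cat_scheme" (structure) +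
  fixes X Y M :: "('o, 'm) cochain" and u i j p q :: "int \<Rightarrow> 'm"
  assumes complex_X [simp]: "cochain_complex C X" and complex_Y [simp]: "cochain_complex C Y"
    and map_u: "cochain_map C X Y u"
    and mapping_cone: "mapping_cone C (X, Y, u) M i j p q"
begin

lemmas u_Mor [simp] = cochain_mapD(1-3)[OF map_u]
lemmas u_diff [simp] = cochain_map_diff[OF map_u] cochain_map_diff_Cmp[OF map_u]

lemma cone_biproduct: "biproduct C (cob X (n + 1)) (cob Y n) (cob M n) (i n) (j n) (p n) (q n)"
  using mapping_cone by (simp add: mapping_cone_def)

lemmas cone_Mor [simp] = biproductD(3-15)[OF cone_biproduct]
lemmas cone_Cmp [simp] = biproductD(16-19)[OF cone_biproduct]
lemmas cone_Add = biproductD(20)[OF cone_biproduct]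

lemma cone_Cmp_Cmp [simp]:
  "x \<in> Mor C \<Longrightarrow> Tgt C x = cob X (n + 1) \<Longrightarrow> p n \<odot> (i n \<odot> x) = x"
  "x \<in> Mor C \<Longrightarrow> Tgt C x = cob Y n \<Longrightarrow> q n \<odot> (j n \<odot> x) = x"
  "x \<in> Mor C \<Longrightarrow> Tgt C x = cob X (n + 1) \<Longrightarrow> q n \<odot> (i n \<odot> x) = Zer C (Src C x) (cob Y n)"
  "x \<in> Mor C \<Longrightarrow> Tgt C x = cob Y n \<Longrightarrow> p n \<odot> (j n \<odot> x) = Zer C (Src C x) (cob X (n + 1))"
  using Cmp_eq_extend[OF cone_Cmp(1), of n x] Cmp_eq_extend[OF cone_Cmp(2), of n x]
    Cmp_eq_extend[OF cone_Cmp(3), of n x] Cmp_eq_extend[OF cone_Cmp(4), of n x] by simp_all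

lemma cone_diff:
  "cdiff M n = Add C (i (n + 1) \<odot> (Neg C (cdiff X (n + 1)) \<odot> p n))
     (Add C (j (n + 1) \<odot> (u (n + 1) \<odot> p n)) (j (n + 1) \<odot> (cdiff Y n \<odot> q n)))"
  using mapping_cone by (simp add: mapping_cone_def)

lemma cone_diff_Mor [simp]:
  "cdiff M n \<in> Mor C" "Src C (cdiff M n) = cob M n" "Tgt C (cdiff M n) = cob M (n + 1)"
  by (simp_all add: cone_diff)

lemma diff_i [simp]:
  "cdiff M n \<odot> i n = Add C (Neg C (i (n + 1) \<odot> cdiff X (n + 1))) (j (n + 1) \<odot> u (n + 1))"
  by (simp add: cone_diff)

lemma diff_j [simp]: "cdiff M n \<odot> j n = j (n + 1) \<odot> cdiff Y n"
  by (simp add: cone_diff)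

lemma p_diff [simp]: "m = n + 1 \<Longrightarrow> p m \<odot> cdiff M n = Neg C (cdiff X m \<odot> p n)"
  by (simp add: cone_diff)

lemma q_diff [simp]:
  "m = n + 1 \<Longrightarrow> q m \<odot> cdiff M n = Add C (u m \<odot> p n) (cdiff Y n \<odot> q n)"
  by (simp add: cone_diff)

lemma cone_diff_Cmp [simp]:
  assumes "x \<in> Mor C"
  shows "Tgt C x = cob X (n + 1) \<Longrightarrow> cdiff M n \<odot> (i n \<odot> x) =
      Add C (Neg C (i (n + 1) \<odot> (cdiff X (n + 1) \<odot> x))) (j (n + 1) \<odot> (u (n + 1) \<odot> x))"
    "Tgt C x = cob Y n \<Longrightarrow> cdiff M n \<odot> (j n \<odot> x) = j (n + 1) \<odot> (cdiff Y n \<odot> x)"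
    "m = n + 1 \<Longrightarrow> Tgt C x = cob M n \<Longrightarrow>
      p m \<odot> (cdiff M n \<odot> x) = Neg C (cdiff X m \<odot> (p n \<odot> x))"
    "m = n + 1 \<Longrightarrow> Tgt C x = cob M n \<Longrightarrow>
      q m \<odot> (cdiff M n \<odot> x) = Add C (u m \<odot> (p n \<odot> x)) (cdiff Y n \<odot> (q n \<odot> x))"
  using assms Cmp_eq_extend[OF diff_i, of n x] Cmp_eq_extend[OF diff_j, of n x]
    Cmp_eq_extend[OF p_diff, of m n x] Cmp_eq_extend[OF q_diff, of m n x] by simp_all

lemma complex_M [simp]: "cochain_complex C M"
proof -
  have "cdiff M (n + 1) \<odot> cdiff M n = Zer C (cob M n) (cob M (n + 2))" for n
    by (rule biproduct_eqI[OF cone_biproduct[of n]]) (auto simp: complex_diff_diff add.commute[of n 2])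
  then show ?thesis by (auto simp: cochain_complex_def in_Hom_iff)
qed

lemma cochain_map_j: "cochain_map C Y M j"
  by (auto simp: cochain_map_def in_Hom_iff)

lemma cochain_map_p: "cochain_map C M (cshift C X) p"
  by (auto simp: cochain_map_def in_Hom_iff)

end

context preadditive_category
begin

lemma Add_Neg_rearrange:
  assumes "w \<in> Mor C" "a \<in> Mor C" "b \<in> Mor C" "e \<in> Mor C"
    "Src C a = Src C w" "Src C b = Src C w" "Src C e = Src C w"
    "Tgt C a = Tgt C w" "Tgt C b = Tgt C w" "Tgt C e = Tgt C w"
  shows "Add C (Add C (Neg C w) a) (Add C (Add C b w) e) = Add C b (Add C a e)"
proof -
  have "Add C (Add C (Neg C w) a) (Add C (Add C b w) e) =
      Add C (Neg C w) (Add C w (Add C b (Add C a e)))"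
    using assms by (simp add: Add_ac del: Add_Neg_cancel)
  then show ?thesis using assms by simp
qed

text \<open>Only the existence of direct sums is needed for that of cones.\<close>

lemma cone_exists:
  assumes "\<And>X Y. X \<in> Ob C \<Longrightarrow> Y \<in> Ob C \<Longrightarrow> \<exists>M i j p q. biproduct C X Y M i j p q"
    and "cochain_complex C X" "cochain_complex C Y" "cochain_map C X Y u"
  obtains M i j p q where "cone C X Y M u i j p q"
proof -
  have "\<forall>n. \<exists>M i j p q. biproduct C (cob X (n + 1)) (cob Y n) M i j p q"
    using assms by simp
  then obtain M0 i j p q where
    *: "\<And>n. biproduct C (cob X (n + 1)) (cob Y n) (M0 n) (i n) (j n) (p n) (q n)"
    by metis
  define M where "M = \<lparr>cob = M0, cdiff = \<lambda>n.
    Add C (i (n + 1) \<odot> (Neg C (cdiff X (n + 1)) \<odot> p n))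
     (Add C (j (n + 1) \<odot> (u (n + 1) \<odot> p n)) (j (n + 1) \<odot> (cdiff Y n \<odot> q n)))\<rparr>"
  have "cone C X Y M u i j p q"
    by unfold_locales (use assms * in \<open>auto simp: mapping_cone_def M_def\<close>)
  then show thesis by (rule that)
qed

text \<open>For a split exact sequence of complexes with maps \<open>u\<close>, \<open>v\<close> and splittings \<open>r\<close>, \<open>s\<close>, the
  comparison map from the cone of \<open>u\<close> to the third term is a homotopy equivalence. Equivalently
  its cone is contractible: on the pair of \<open>x\<close> in the cone of \<open>u\<close> and \<open>z\<close> in the third term, a
  contraction is \<open>(x, z) \<mapsto> (- i r q x + j s z, 0)\<close>.\<close>

lemma contractible_comparison_cone:
  assumes "cone C X Y M u i j p q" and "cone C M Z N (\<lambda>n. v n \<odot> q n) I J P Q"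
    and v: "cochain_map C Y Z v" and s: "cochain_map C Z Y s" and r: "cochain_map C Y X r"
    and vu: "\<And>n. v n \<odot> u n = Zer C (cob X n) (cob Z n)"
    and vs: "\<And>n. v n \<odot> s n = Idt C (cob Z n)"
    and ur: "\<And>n. Add C (u n \<odot> r n) (s n \<odot> v n) = Idt C (cob Y n)"
    and ru: "\<And>n. r n \<odot> u n = Idt C (cob X n)"
  shows "contractible C N"
proof -
  interpret M: cone C X Y M u i j p q by fact
  interpret N: cone C M Z N "\<lambda>n. v n \<odot> q n" I J P Q by fact
  note [simp] = cochain_mapD(1-3)[OF v] cochain_mapD(1-3)[OF s] cochain_mapD(1-3)[OF r]
    cochain_map_diff[OF r] cochain_map_diff_Cmp[OF r] cochain_map_diff[OF s]
    cochain_map_diff_Cmp[OF s] vu vs ru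
  have [simp]: "v n \<odot> (u n \<odot> x) = Zer C (Src C x) (cob Z n)" "r n \<odot> (u n \<odot> x) = x"
    if "x \<in> Mor C" "Tgt C x = cob X n" for n x
    using that Cmp_eq_extend[OF vu, of n x] Cmp_eq_extend[OF ru, of n x] by simp_all
  define c where "c n = I (n - 1) \<odot>
    Add C (Neg C (i n \<odot> (r (n + 1) \<odot> (q (n + 1) \<odot> P n)))) (j n \<odot> (s n \<odot> Q n))" for n
  have c_Mor [simp]: "c n \<in> Mor C" "Src C (c n) = cob N n" "Tgt C (c n) = cob N (n - 1)" for n
    by (simp_all add: c_def)
  have cI: "c n \<odot> I n = Neg C (I (n - 1) \<odot> (i n \<odot> (r (n + 1) \<odot> q (n + 1))))" for n
    by (simp add: c_def)
  have cJ: "c n \<odot> J n = I (n - 1) \<odot> (j n \<odot> s n)" for n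
    by (simp add: c_def)
  have cI': "c n \<odot> (I n \<odot> x) = Neg C (I (n - 1) \<odot> (i n \<odot> (r (n + 1) \<odot> (q (n + 1) \<odot> x))))"
    if "x \<in> Mor C" "Tgt C x = cob M (n + 1)" for n x
    using that Cmp_eq_extend[OF cI, of n x] by simp
  have cJ': "c n \<odot> (J n \<odot> x) = I (n - 1) \<odot> (j n \<odot> (s n \<odot> x))"
    if "x \<in> Mor C" "Tgt C x = cob Z n" for n x
    using that Cmp_eq_extend[OF cJ, of n x] by simp
  note [simp] = cI cJ cI' cJ'
  have "htpy_boundary C N N c n = Idt C (cob N n)" for n
  proof (rule biproduct_eqI[OF N.cone_biproduct[of n]])
    have "I n \<odot> (j (n + 1) \<odot> (Add C (u (n + 1) \<odot> r (n + 1)) (s (n + 1) \<odot> v (n + 1)) \<odot> q (n + 1))) =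
        I n \<odot> (j (n + 1) \<odot> q (n + 1))"
      unfolding ur by simp
    then have jq: "Add C (I n \<odot> j (n + 1) \<odot> u (n + 1) \<odot> r (n + 1) \<odot> q (n + 1))
        (I n \<odot> j (n + 1) \<odot> s (n + 1) \<odot> v (n + 1) \<odot> q (n + 1)) = I n \<odot> j (n + 1) \<odot> q (n + 1)"
      by simp
    have "I n \<odot> Add C (i (n + 1) \<odot> p (n + 1)) (j (n + 1) \<odot> q (n + 1)) = I n"
      unfolding M.cone_Add by simp
    then have ip: "Add C (I n \<odot> i (n + 1) \<odot> p (n + 1)) (I n \<odot> j (n + 1) \<odot> q (n + 1)) = I n"
      by simp
    show "htpy_boundary C N N c n \<odot> I n = Idt C (cob N n) \<odot> I n"
      by (simp add: htpy_boundary_def Add_Neg_rearrange jq ip)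
    show "htpy_boundary C N N c n \<odot> J n = Idt C (cob N n) \<odot> J n"
      by (simp add: htpy_boundary_def Add_assoc Add_commute[of "J n"])
  qed (auto simp: htpy_boundary_def)
  then show ?thesis
    by (intro contractibleI[where s = c]) (auto simp: degree_minus_one_def in_Hom_iff)
qed

text \<open>Up to isomorphism the cone of a shifted map is the shift of the cone: the isomorphism is
  \<open>(x, y) \<mapsto> (x, - y)\<close>.\<close>

lemma contractible_cone_cshift:
  assumes "cone C X Y M u i j p q"
    and "cone C (cshift C X) (cshift C Y) M' (\<lambda>n. u (n + 1)) i' j' p' q'"
    and "contractible C M"
  shows "contractible C M'"
proof -
  interpret M: cone C X Y M u i j p q by fact
  interpret M': cone C "cshift C X" "cshift C Y" M' "\<lambda>n. u (n + 1)" i' j' p' q' by fact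
  \<comment> \<open>The terms of \<open>M'\<close> are those of \<open>X\<close> and \<open>Y\<close> in shifted degrees; the rules for \<open>M'\<close> are
    rewritten accordingly, to match the normal form of the goals.\<close>
  note [simp] = M'.cone_Mor[unfolded cshift_simps] M'.cone_Cmp[unfolded cshift_simps]
    M'.cone_Cmp_Cmp[unfolded cshift_simps] M'.cone_diff_Cmp[unfolded cshift_simps]
    M'.diff_i[unfolded cshift_simps] M'.diff_j[unfolded cshift_simps]
    M'.p_diff[unfolded cshift_simps] M'.q_diff[unfolded cshift_simps]
  define \<theta> where "\<theta> n = Add C (i (n + 1) \<odot> p' n) (Neg C (j (n + 1) \<odot> q' n))" for n
  define \<theta>' where "\<theta>' n = Add C (i' n \<odot> p (n + 1)) (Neg C (j' n \<odot> q (n + 1)))" for n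
  have [simp]: "\<theta> n \<in> Mor C" "Src C (\<theta> n) = cob M' n" "Tgt C (\<theta> n) = cob M (n + 1)"
    "\<theta>' n \<in> Mor C" "Tgt C (\<theta>' n) = cob M' n" "Src C (\<theta>' n) = cob M (n + 1)" for n
    by (simp_all add: \<theta>_def \<theta>'_def)
  have "\<theta> (n + 1) \<odot> cdiff M' n = cdiff (cshift C M) n \<odot> \<theta> n" for n
    by (rule biproduct_eqI[OF M'.cone_biproduct[of n]]) (auto simp: \<theta>_def)
  then have \<theta>: "cochain_map C M' (cshift C M) \<theta>"
    by (auto simp: cochain_map_def in_Hom_iff)
  have "\<theta>' (n + 1) \<odot> cdiff (cshift C M) n = cdiff M' n \<odot> \<theta>' n" for n
    by (rule biproduct_eqI[OF M.cone_biproduct[of "n + 1"]]) (auto simp: \<theta>'_def)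
  then have \<theta>': "cochain_map C (cshift C M) M' \<theta>'"
    by (auto simp: cochain_map_def in_Hom_iff)
  have "\<theta>' n \<odot> \<theta> n = Idt C (cob M' n)" for n
    by (rule biproduct_eqI[OF M'.cone_biproduct[of n]]) (auto simp: \<theta>_def \<theta>'_def)
  then have "Cmp (Ch C) (cshift C M, M', \<theta>') (M', cshift C M, \<theta>) = Idt (Ch C) M'" by simp
  then show ?thesis
    using homotopy_refl[of "Idt (Ch C) M'"] \<theta> \<theta>'
    by (intro contractible_retract[OF contractible_cshift[OF assms(3)],
          of "(M', cshift C M, \<theta>)" M' "(cshift C M, M', \<theta>')"])
      (auto simp: in_Hom_iff complex_cshift cochain_map_Idt)
qed

end

section \<open>The functor on complexes\<close>

lemma Ch_fnctr_simps [simp]: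
  "cob (FOb (Ch_fnctr F) X) n = FOb F (cob X n)"
  "cdiff (FOb (Ch_fnctr F) X) n = FMor F (cdiff X n)"
  "FMor (Ch_fnctr F) (X, Y, u) = (FOb (Ch_fnctr F) X, FOb (Ch_fnctr F) Y, \<lambda>n. FMor F (u n))"
  by (simp_all add: Ch_fnctr_def)

text \<open>An additive functor \<open>F\<close>. Its source is abelian so that cones exist there; in the target only
  the images of these cones occur.\<close>

locale additive_functor_from_abelian = A: abelian_category A + B: preadditive_category B
  for A :: "('a, 'f) add_cat" and B :: "('b, 'g) add_cat" +
  fixes F :: "('a, 'f, 'b, 'g) fnctr"
  assumes additive_F: "additive_functor A B F"
begin

lemma functor_F: "cat_functor A B F"
  using additive_F by (simp add: additive_functor_def)

lemma FOb_in_Ob [simp]: "X \<in> Ob A \<Longrightarrow> FOb F X \<in> Ob B"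
  by (rule cat_functor.FOb[OF functor_F])

lemma FMor_in_Mor [simp]:
  assumes "f \<in> Mor A"
  shows "FMor F f \<in> Mor B" "Src B (FMor F f) = FOb F (Src A f)"
    "Tgt B (FMor F f) = FOb F (Tgt A f)"
  using cat_functor.FMor[OF functor_F, of f "Src A f" "Tgt A f"] assms by (auto simp: in_Hom_iff)

lemma FMor_Idt [simp]: "X \<in> Ob A \<Longrightarrow> FMor F (Idt A X) = Idt B (FOb F X)"
  by (rule cat_functor.FMor_Idt[OF functor_F])

lemma FMor_Cmp [simp]:
  "f \<in> Mor A \<Longrightarrow> g \<in> Mor A \<Longrightarrow> Src A g = Tgt A f \<Longrightarrow>
    FMor F (Cmp A g f) = Cmp B (FMor F g) (FMor F f)"
  by (rule cat_functor.FMor_Cmp[OF functor_F]) (auto simp: in_Hom_iff)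

lemma FMor_Add [simp]:
  assumes "f \<in> Mor A" "g \<in> Mor A" "Src A g = Src A f" "Tgt A g = Tgt A f"
  shows "FMor F (Add A f g) = Add B (FMor F f) (FMor F g)"
proof -
  have "f \<in> Hom A (Src A f) (Tgt A f)" "g \<in> Hom A (Src A f) (Tgt A f)"
    using assms by (simp_all add: in_Hom_iff)
  then show ?thesis
    using additive_F A.Src_Ob[OF assms(1)] A.Tgt_Ob[OF assms(1)]
    unfolding additive_functor_def by blast
qed

lemma FMor_Zer [simp]:
  assumes "X \<in> Ob A" "Y \<in> Ob A"
  shows "FMor F (Zer A X Y) = Zer B (FOb F X) (FOb F Y)"
proof -
  have "Add B (FMor F (Zer A X Y)) (FMor F (Zer A X Y)) = FMor F (Add A (Zer A X Y) (Zer A X Y))"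
    by (rule FMor_Add[symmetric]) (use assms in auto)
  also have "\<dots> = FMor F (Zer A X Y)" using assms by simp
  finally have "FMor F (Zer A X Y) =
      Zer B (Src B (FMor F (Zer A X Y))) (Tgt B (FMor F (Zer A X Y)))"
    by (rule B.Add_idem_Zer) (use assms in auto)
  also have "\<dots> = Zer B (FOb F X) (FOb F Y)" using assms by simp
  finally show ?thesis .
qed

lemma FMor_Neg [simp]:
  assumes "f \<in> Mor A"
  shows "FMor F (Neg A f) = Neg B (FMor F f)"
proof (rule B.Neg_unique)
  have "Add B (FMor F f) (FMor F (Neg A f)) = FMor F (Add A f (Neg A f))"
    by (rule FMor_Add[symmetric]) (use assms in auto)
  then show "Add B (FMor F f) (FMor F (Neg A f)) = Zer B (Src B (FMor F f)) (Tgt B (FMor F f))"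
    using assms A.Src_Ob A.Tgt_Ob by simp
qed (use assms in auto)

lemma FOb_complex:
  assumes "cochain_complex A X"
  shows "cochain_complex B (FOb (Ch_fnctr F) X)"
proof -
  have "Cmp B (FMor F (cdiff X (n + 1))) (FMor F (cdiff X n)) =
      Zer B (FOb F (cob X n)) (FOb F (cob X (n + 2)))" for n
    using arg_cong[OF A.complexD(5)[OF assms, of n], of "FMor F"]
    by (simp add: assms del: A.complexD(5))
  then show ?thesis
    unfolding cochain_complex_def[of B] using A.complexD(1-4)[OF assms] by (auto simp: in_Hom_iff)
qed

lemma FMor_cochain_map:
  assumes "cochain_map A X Y u" "cochain_complex A X" "cochain_complex A Y"
  shows "cochain_map B (FOb (Ch_fnctr F) X) (FOb (Ch_fnctr F) Y) (\<lambda>n. FMor F (u n))"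
proof -
  note [simp] = assms(2,3) A.cochain_mapD(1-3)[OF assms(1)]
  have "Cmp B (FMor F (u (n + 1))) (FMor F (cdiff X n)) =
      Cmp B (FMor F (cdiff Y n)) (FMor F (u n))" for n
    using arg_cong[OF A.cochain_mapD(4)[OF assms(1), of n], of "FMor F"] by simp
  then show ?thesis unfolding cochain_map_def[of B] by (auto simp: in_Hom_iff)
qed

lemma FMor_homotopy:
  assumes "(f, g) \<in> homotopy A"
  shows "(FMor (Ch_fnctr F) f, FMor (Ch_fnctr F) g) \<in> homotopy B"
proof -
  obtain X Y u v s where fg: "f = (X, Y, u)" "g = (X, Y, v)" "cochain_complex A X"
    "cochain_complex A Y" "cochain_map A X Y u" "cochain_map A X Y v"
    "degree_minus_one A X Y s" "\<And>n. u n = Add A (v n) (htpy_boundary A X Y s n)"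
    using assms by (rule homotopyE) metis
  note [simp] = A.cochain_mapD(1-3)[OF fg(6)] A.degree_minus_oneD[OF fg(7)] fg(3,4)
    A.htpy_boundary_in_Mor[OF fg(7,3,4)]
  have "FMor F (htpy_boundary A X Y s n) = htpy_boundary B (FOb (Ch_fnctr F) X)
      (FOb (Ch_fnctr F) Y) (\<lambda>n. FMor F (s n)) n" for n
    by (simp add: htpy_boundary_def)
  then have "FMor F (u n) = Add B (FMor F (v n)) (htpy_boundary B (FOb (Ch_fnctr F) X)
      (FOb (Ch_fnctr F) Y) (\<lambda>n. FMor F (s n)) n)" for n
    using arg_cong[OF fg(8), of "FMor F" n] by simp
  then show ?thesis unfolding fg(1,2) Ch_fnctr_simps
    using FOb_complex[OF fg(3)] FOb_complex[OF fg(4)] FMor_cochain_map[OF fg(5,3,4)]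
      FMor_cochain_map[OF fg(6,3,4)]
    by (intro homotopyI[where s = "\<lambda>n. FMor F (s n)"]) (auto simp: degree_minus_one_def in_Hom_iff)
qed

lemma FOb_cshift:
  "cochain_complex A X \<Longrightarrow> FOb (Ch_fnctr F) (cshift A X) = cshift B (FOb (Ch_fnctr F) X)"
  by (simp add: Ch_fnctr_def cshift_def)

lemma cone_FMor:
  assumes "cone A X Y M u i j p q"
  shows "cone B (FOb (Ch_fnctr F) X) (FOb (Ch_fnctr F) Y) (FOb (Ch_fnctr F) M)
    (\<lambda>n. FMor F (u n)) (\<lambda>n. FMor F (i n)) (\<lambda>n. FMor F (j n)) (\<lambda>n. FMor F (p n)) (\<lambda>n. FMor F (q n))"
proof -
  interpret cone A X Y M u i j p q by fact
  have "biproduct B (FOb F (cob X (n + 1))) (FOb F (cob Y n)) (FOb F (cob M n))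
      (FMor F (i n)) (FMor F (j n)) (FMor F (p n)) (FMor F (q n))" for n
    unfolding biproduct_def in_Hom_iff
    using arg_cong[OF cone_Add[of n], of "FMor F"] arg_cong[OF cone_Cmp(1)[of n], of "FMor F"]
      arg_cong[OF cone_Cmp(2)[of n], of "FMor F"] arg_cong[OF cone_Cmp(3)[of n], of "FMor F"]
      arg_cong[OF cone_Cmp(4)[of n], of "FMor F"]
    by (simp del: cone_Cmp)
  then show ?thesis
    by unfold_locales (auto simp: FOb_complex FMor_cochain_map map_u mapping_cone_def cone_diff)
qed

section \<open>The class of maps to be inverted\<close>

lemma F_kernel_iff:
  "S \<in> F_kernel A B F \<longleftrightarrow> cochain_complex A S \<and> contractible B (FOb (Ch_fnctr F) S)"
  by (simp add: F_kernel_def A.Ob_K)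

lemma F_kernel_iso:
  assumes "is_iso (K A) c" "c \<in> Hom (K A) M W" "W \<in> F_kernel A B F"
  shows "M \<in> F_kernel A B F"
proof -
  interpret K: category "K A" by (rule A.category_K)
  obtain c' where c': "c' \<in> Hom (K A) W M" "Cmp (K A) c' c = Idt (K A) M"
    using K.is_isoE[OF assms(1,2)] by metis
  obtain u where u: "c = K_mor A (M, W, u)" "cochain_map A M W u" "cochain_complex A M"
    "cochain_complex A W" using assms(2) by (rule A.Hom_K_E)
  obtain v where v: "c' = K_mor A (W, M, v)" "cochain_map A W M v"
    using c'(1) by (rule A.Hom_K_E)
  have "K_mor A (Cmp (Ch A) (W, M, v) (M, W, u)) = K_mor A (Idt (Ch A) M)"
    using c'(2) u(2-4) v(2) unfolding u(1) v(1) A.K_mor_Idt[symmetric]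
    by (subst A.K_mor_Cmp[symmetric]) auto
  then have "(Cmp (Ch A) (W, M, v) (M, W, u), Idt (Ch A) M) \<in> homotopy A"
    by (rule A.K_mor_eqD) (use u in \<open>auto intro: A.cochain_map_Idt\<close>)
  from FMor_homotopy[OF this]
  have hom: "(Cmp (Ch B) (FMor (Ch_fnctr F) (W, M, v)) (FMor (Ch_fnctr F) (M, W, u)),
      Idt (Ch B) (FOb (Ch_fnctr F) M)) \<in> homotopy B"
    using u(3) A.cochain_mapD[OF u(2)] A.cochain_mapD[OF v(2)] by simp
  have "contractible B (FOb (Ch_fnctr F) W)"
    using assms(3) by (simp add: F_kernel_iff)
  then have "contractible B (FOb (Ch_fnctr F) M)"
    by (rule B.contractible_retract[OF _ _ _ hom])
      (use FMor_cochain_map[OF u(2-4)] FMor_cochain_map[OF v(2) u(4,3)] FOb_complex[OF u(3)]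
        FOb_complex[OF u(4)] in \<open>auto simp: in_Hom_iff\<close>)
  then show ?thesis using u(3) by (simp add: F_kernel_iff)
qed

lemma triangle_cone:
  assumes "cone A X Y M u i j p q"
  shows "triangle (K A) (K_mor A (X, Y, u), K_mor A (Y, M, j), K_mor A (M, cshift A X, p))"
    and "(K_mor A (X, Y, u), K_mor A (Y, M, j), K_mor A (M, cshift A X, p)) \<in> cone_triangles A"
proof -
  interpret cone A X Y M u i j p q by fact
  show "triangle (K A) (K_mor A (X, Y, u), K_mor A (Y, M, j), K_mor A (M, cshift A X, p))"
    using map_u cochain_map_j cochain_map_p A.complex_cshift
    by (simp add: triangle_def A.K_mor_in_Mor) (simp add: K_simps)
  show "(K_mor A (X, Y, u), K_mor A (Y, M, j), K_mor A (M, cshift A X, p)) \<in> cone_triangles A"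
    using map_u mapping_cone by (fastforce simp: cone_triangles_def)
qed

lemma triangle_iso_K_refl:
  assumes "triangle (K A) (u, v, w)"
  shows "triangle_iso (K A) (u, v, w) (u, v, w)"
proof -
  interpret K: category "K A" by (rule A.category_K)
  have uvw: "u \<in> Mor (K A)" "v \<in> Mor (K A)" "w \<in> Mor (K A)" "Src (K A) v = Tgt (K A) u"
    "Src (K A) w = Tgt (K A) v" "Tgt (K A) w = cshift A (Src (K A) u)"
    using assms by (auto simp: triangle_def) (simp add: K_simps)
  note [simp] = uvw(1-3) K.Src_Ob K.Tgt_Ob
  show ?thesis unfolding triangle_iso_def split
    by (intro conjI assms exI[of _ "Idt (K A) (Src (K A) u)"] exI[of _ "Idt (K A) (Src (K A) v)"]
        exI[of _ "Idt (K A) (Src (K A) w)"])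
      (use uvw(4-) in \<open>auto simp: K.is_iso_Idt in_Hom_iff A.ShMor_K_Idt\<close>)
qed

lemma cone_triangle_Dist:
  assumes "cone A X Y M u i j p q"
  shows "(K_mor A (X, Y, u), K_mor A (Y, M, j), K_mor A (M, cshift A X, p)) \<in> Dist (K A)"
  using triangle_cone[OF assms] triangle_iso_K_refl unfolding Dist_K by blast

lemma cone_in_kernelI:
  assumes "cone A X Y M u i j p q" "contractible B (FOb (Ch_fnctr F) M)"
  shows "K_mor A (X, Y, u) \<in> cone_in (K A) (F_kernel A B F)"
proof -
  interpret cone A X Y M u i j p q by fact
  have "Tgt (K A) (K_mor A (Y, M, j)) = M"
    using cochain_map_j by (simp add: A.K_mor_in_Mor)
  then show ?thesis
    using cone_triangle_Dist[OF assms(1)] assms(2) unfolding cone_in_def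
    by (auto simp: F_kernel_iff)
qed

text \<open>The class of maps with cone in the kernel of the functor is closed under the shift. A
  distinguished triangle on \<open>s[1]\<close> is obtained from the cone of the shift of a map isomorphic
  to \<open>s\<close>.\<close>

lemma cone_in_kernel_ShMor:
  assumes "s \<in> cone_in (K A) (F_kernel A B F)"
  shows "ShMor (K A) s \<in> cone_in (K A) (F_kernel A B F)"
proof -
  interpret K: category "K A" by (rule A.category_K)
  obtain v w where svw: "(s, v, w) \<in> Dist (K A)" "Tgt (K A) v \<in> F_kernel A B F"
    using assms by (auto simp: cone_in_def)
  then obtain X Y M u i j p q where u: "(X, Y, u) \<in> Mor (Ch A)"
      "mapping_cone A (X, Y, u) M i j p q" and
    iso: "triangle_iso (K A) (K_mor A (X, Y, u), K_mor A (Y, M, j), K_mor A (M, cshift A X, p))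
      (s, v, w)"
    by (auto simp: Dist_K cone_triangles_def)
  interpret M: cone A X Y M u i j p q by unfold_locales (use u in auto)
  note [simp] = M.map_u M.cochain_map_j M.cochain_map_p
  have u_j: "K_mor A (X, Y, u) \<in> Hom (K A) X Y" "K_mor A (Y, M, j) \<in> Hom (K A) Y M"
    "K_mor A (M, cshift A X, p) \<in> Hom (K A) M (cshift A X)"
    by (auto intro!: A.K_mor_Hom A.complex_cshift)
  obtain a b c where abc: "is_iso (K A) a" "is_iso (K A) b" "is_iso (K A) c"
    "a \<in> Hom (K A) X (Src (K A) s)" "b \<in> Hom (K A) Y (Src (K A) v)"
    "c \<in> Hom (K A) M (Src (K A) w)" "Cmp (K A) b (K_mor A (X, Y, u)) = Cmp (K A) s a"
    and tri: "triangle (K A) (s, v, w)"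
    using iso u_j by (auto simp: triangle_iso_def in_Hom_iff)
  have s: "s \<in> Hom (K A) (Src (K A) s) (Src (K A) v)" and w: "Src (K A) w = Tgt (K A) v"
    using tri by (auto simp: triangle_def in_Hom_iff)
  have M_ker: "contractible B (FOb (Ch_fnctr F) M)"
    using F_kernel_iso[OF abc(3,6)] svw(2) w by (simp add: F_kernel_iff)
  have cmu: "cochain_map A (cshift A X) (cshift A Y) (\<lambda>n. u (n + 1))"
    using M.map_u by (rule A.cochain_map_cshift) simp_all
  obtain M' i' j' p' q' where
    M': "cone A (cshift A X) (cshift A Y) M' (\<lambda>n. u (n + 1)) i' j' p' q'"
    using A.cone_exists[OF A.ex_biproduct A.complex_cshift[OF M.complex_X]
      A.complex_cshift[OF M.complex_Y] cmu] by metis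
  interpret M': cone A "cshift A X" "cshift A Y" M' "\<lambda>n. u (n + 1)" i' j' p' q' by fact
  have "contractible B (FOb (Ch_fnctr F) M')"
    using B.contractible_cone_cshift[OF cone_FMor[OF M.cone_axioms]
      cone_FMor[OF M'.cone_axioms, unfolded FOb_cshift[OF M.complex_X]
        FOb_cshift[OF M.complex_Y]] M_ker] .
  then have M'_ker: "M' \<in> F_kernel A B F" by (simp add: F_kernel_iff)
  let ?u = "K_mor A (cshift A X, cshift A Y, \<lambda>n. u (n + 1))"
  let ?j = "K_mor A (cshift A Y, M', j')" and ?p = "K_mor A (M', cshift A (cshift A X), p')"
  let ?a = "ShMor (K A) a" and ?b = "ShMor (K A) b"
  let ?X = "cshift A (Src (K A) s)" and ?Y = "cshift A (Src (K A) v)"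
  have u': "?u = ShMor (K A) (K_mor A (X, Y, u))"
    using u(1) by (simp add: A.ShMor_K_mor cshift_map_simp)
  have a: "is_iso (K A) ?a" "?a \<in> Hom (K A) (cshift A X) ?X"
    using A.ShMor_K_iso A.ShMor_K_Hom abc(1,4) by auto
  have b: "is_iso (K A) ?b" "?b \<in> Hom (K A) (cshift A Y) ?Y"
    using A.ShMor_K_iso A.ShMor_K_Hom abc(2,5) by auto
  obtain \<beta> where \<beta>: "\<beta> \<in> Hom (K A) ?Y (cshift A Y)" "Cmp (K A) \<beta> ?b = Idt (K A) (cshift A Y)"
    using K.is_isoE[OF b] by metis
  have h: "?u \<in> Hom (K A) (cshift A X) (cshift A Y)" "?j \<in> Hom (K A) (cshift A Y) M'"
    "?p \<in> Hom (K A) M' (cshift A (cshift A X))"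
    using M'.map_u M'.cochain_map_j M'.cochain_map_p
    by (auto intro!: A.K_mor_Hom A.complex_cshift)
  have sh: "ShMor (K A) s \<in> Hom (K A) ?X ?Y" by (rule A.ShMor_K_Hom[OF s])
  have aa: "ShMor (K A) ?a \<in> Hom (K A) (cshift A (cshift A X)) (cshift A ?X)"
    by (rule A.ShMor_K_Hom[OF a(2)])
  have sq: "Cmp (K A) ?b ?u = Cmp (K A) (ShMor (K A) s) ?a"
    unfolding u' using A.ShMor_K_Cmp[OF u_j(1) abc(5)] A.ShMor_K_Cmp[OF abc(4) s] abc(7) by simp
  note H = h[unfolded in_Hom_iff] a(2)[unfolded in_Hom_iff] b(2)[unfolded in_Hom_iff]
    \<beta>(1)[unfolded in_Hom_iff] sh[unfolded in_Hom_iff] aa[unfolded in_Hom_iff]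
  have M'_Ob: "M' \<in> Ob (K A)" by (simp add: A.Ob_K)
  have ShOb: "ShOb (K A) = cshift A" by (simp add: K_simps)
  have "triangle_iso (K A) (?u, ?j, ?p)
      (ShMor (K A) s, Cmp (K A) ?j \<beta>, Cmp (K A) (ShMor (K A) ?a) ?p)"
    unfolding triangle_iso_def split
    by (intro conjI exI[of _ ?a] exI[of _ ?b] exI[of _ "Idt (K A) M'"] a(1) b(1)
        K.is_iso_Idt[OF M'_Ob] triangle_cone(1)[OF M'] sq)
      (use H \<beta>(2) M'_Ob in \<open>auto simp: triangle_def in_Hom_iff ShOb\<close>)
  then have "(ShMor (K A) s, Cmp (K A) ?j \<beta>, Cmp (K A) (ShMor (K A) ?a) ?p) \<in> Dist (K A)"
    using triangle_cone(2)[OF M'] unfolding Dist_K by blast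
  moreover have "Tgt (K A) (Cmp (K A) ?j \<beta>) = M'" using H by simp
  ultimately show ?thesis using M'_ker unfolding cone_in_def by auto
qed

end

section \<open>Localisations\<close>

lemma zz_cat_simps [simp]:
  "Ob (zz_cat C S) = Ob C" "(X, Y, p) \<in> Mor (zz_cat C S) \<longleftrightarrow> zz_path C S X Y p"
  "Src (zz_cat C S) (X, Y, p) = X" "Tgt (zz_cat C S) (X, Y, p) = Y"
  "Idt (zz_cat C S) X = (X, X, [])"
  "Cmp (zz_cat C S) (Y', Z, q) (X, Y, p) = (X, Z, p @ q)"
  by (simp_all add: zz_cat_def)

context category
begin

lemma zz_path_ends: "zz_path C S X Y p \<Longrightarrow> X \<in> Ob C \<and> Y \<in> Ob C"
  by (induction rule: zz_path.induct) (auto simp: in_Hom_iff Src_Ob Tgt_Ob)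

lemma zz_path_append: "zz_path C S X Y p \<Longrightarrow> zz_path C S Y Z q \<Longrightarrow> zz_path C S X Z (p @ q)"
  by (induction rule: zz_path.induct) (auto intro: zz_path.intros)

lemma category_zz: "category (zz_cat C S)"
  by unfold_locales
    (auto simp: in_Hom_iff zz_path_ends intro: zz_path_append zz_path.Nil dest: zz_path_ends)

lemma zz_fwd_path: "f \<in> Hom C X Y \<Longrightarrow> zz_fwd C f = (X, Y, [Fwd f]) \<and> zz_path C S X Y [Fwd f]"
  by (auto simp: zz_fwd_def in_Hom_iff intro!: zz_path.intros Tgt_Ob)

lemma zz_bwd_path:
  "s \<in> Hom C X Y \<Longrightarrow> s \<in> S \<Longrightarrow> zz_bwd C s = (Y, X, [Bwd s]) \<and> zz_path C S Y X [Bwd s]"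
  by (auto simp: zz_bwd_def in_Hom_iff intro!: zz_path.intros Src_Ob)

lemma zz_cong_parallel:
  "(a, b) \<in> zz_cong C S \<Longrightarrow> a \<in> Mor (zz_cat C S) \<and> b \<in> Mor (zz_cat C S) \<and>
     Src (zz_cat C S) a = Src (zz_cat C S) b \<and> Tgt (zz_cat C S) a = Tgt (zz_cat C S) b"
proof (induction rule: zz_cong.induct)
  case (Cmp a a' b b')
  interpret zz: category "zz_cat C S" by (rule category_zz)
  from Cmp show ?case by auto
next
  case (fwd_Idt X)
  then show ?case using zz_fwd_path[OF Idt_Hom[OF fwd_Idt]] by (auto intro: zz_path.Nil)
next
  case (fwd_Cmp f X Y g Z)
  then show ?case
    using zz_fwd_path[OF Cmp_Hom[OF fwd_Cmp]] zz_fwd_path[OF fwd_Cmp(1)]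
      zz_fwd_path[OF fwd_Cmp(2)] zz_path_append[of S X Y "[Fwd f]" Z "[Fwd g]"] by auto
next
  case (bwd_fwd s X Y)
  then show ?case
    using zz_fwd_path[OF bwd_fwd(1)] zz_bwd_path[OF bwd_fwd]
      zz_path_append[of S X Y "[Fwd s]" X "[Bwd s]"] zz_path_ends[of S X Y "[Fwd s]"]
    by (auto intro: zz_path.Nil)
next
  case (fwd_bwd s X Y)
  then show ?case
    using zz_fwd_path[OF fwd_bwd(1)] zz_bwd_path[OF fwd_bwd]
      zz_path_append[of S Y X "[Bwd s]" Y "[Fwd s]"] zz_path_ends[of S X Y "[Fwd s]"]
    by (auto intro: zz_path.Nil)
qed auto

lemma congruence_zz: "cat_congruence (zz_cat C S) (zz_cong C S)"
proof -
  interpret zz: category "zz_cat C S" by (rule category_zz)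
  show ?thesis
  proof
    show "equiv (Mor (zz_cat C S)) (zz_cong C S)"
    proof (rule equivI)
      show "zz_cong C S \<subseteq> Mor (zz_cat C S) \<times> Mor (zz_cat C S)"
        by (auto dest!: zz_cong_parallel)
      show "refl_on (Mor (zz_cat C S)) (zz_cong C S)"
        by (rule refl_onI) (rule zz_cong.refl)
      show "sym (zz_cong C S)" by (rule symI) (rule zz_cong.sym)
      show "trans (zz_cong C S)" by (rule transI) (rule zz_cong.trans)
    qed
  next
    fix a b assume "(a, b) \<in> zz_cong C S"
    then show "Src (zz_cat C S) a = Src (zz_cat C S) b \<and> Tgt (zz_cat C S) a = Tgt (zz_cat C S) b"
      using zz_cong_parallel by blast
  next
    fix a a' b b' assume "(a, a') \<in> zz_cong C S" "(b, b') \<in> zz_cong C S"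
      "Src (zz_cat C S) b = Tgt (zz_cat C S) a"
    then show "(Cmp (zz_cat C S) b a, Cmp (zz_cat C S) b' a') \<in> zz_cong C S"
      by (intro zz_cong.Cmp) auto
  qed
qed

lemma category_localisation: "category (localisation C S)"
  unfolding localisation_def by (rule cat_congruence.category_quot[OF congruence_zz])

lemma loc_mor_Hom:
  assumes "f \<in> Hom C X Y"
  shows "loc_mor C S f \<in> Hom (localisation C S) X Y"
  using cat_congruence.class_in_Mor[OF congruence_zz, of "zz_fwd C f" S] zz_fwd_path[OF assms, of S]
  by (simp add: loc_mor_def localisation_def in_Hom_iff)

lemma loc_mor_Cmp:
  assumes "f \<in> Hom C X Y" "g \<in> Hom C Y Z"
  shows "loc_mor C S (g \<odot> f) = Cmp (localisation C S) (loc_mor C S g) (loc_mor C S f)"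
proof -
  have "Cmp (localisation C S) (loc_mor C S g) (loc_mor C S f) =
      zz_cong C S `` {Cmp (zz_cat C S) (zz_fwd C g) (zz_fwd C f)}"
    unfolding loc_mor_def localisation_def
    by (rule cat_congruence.Cmp_class[OF congruence_zz])
      (use zz_fwd_path[OF assms(1), of S] zz_fwd_path[OF assms(2), of S] in auto)
  also have "\<dots> = loc_mor C S (g \<odot> f)"
    unfolding loc_mor_def
    by (rule cat_congruence.class_eqI[OF congruence_zz, symmetric])
      (rule zz_cong.fwd_Cmp[OF assms])
  finally show ?thesis by simp
qed

lemma loc_mor_iso:
  assumes "s \<in> Hom C X Y" "s \<in> S"
  shows "is_iso (localisation C S) (loc_mor C S s)"
proof -
  interpret zz: cat_congruence "zz_cat C S" "zz_cong C S" by (rule congruence_zz)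
  interpret L: category "localisation C S" by (rule category_localisation)
  let ?t = "zz_cong C S `` {zz_bwd C s}"
  note paths = zz_fwd_path[OF assms(1), of S] zz_bwd_path[OF assms]
  show ?thesis
  proof (rule L.is_isoI[OF loc_mor_Hom[OF assms(1)]])
    show "?t \<in> Hom (localisation C S) Y X"
      using zz.class_in_Mor[of "zz_bwd C s"] paths
      by (simp add: localisation_def in_Hom_iff)
    show "Cmp (localisation C S) ?t (loc_mor C S s) = Idt (localisation C S) X"
      using zz.Cmp_class[of "zz_fwd C s" "zz_bwd C s"] zz.class_eqI[OF zz_cong.bwd_fwd[OF assms]]
        paths unfolding loc_mor_def localisation_def zz.Idt_quot by simp
    show "Cmp (localisation C S) (loc_mor C S s) ?t = Idt (localisation C S) Y"
      using zz.Cmp_class[of "zz_bwd C s" "zz_fwd C s"] zz.class_eqI[OF zz_cong.fwd_bwd[OF assms]]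
        paths unfolding loc_mor_def localisation_def zz.Idt_quot by simp
  qed
qed

end

section \<open>Triangles in a Verdier localisation\<close>

lemma verdier_shift_cat_simps:
  "Ob (verdier_shift_cat T N) = Ob (localisation T (cone_in T N))"
  "Mor (verdier_shift_cat T N) = Mor (localisation T (cone_in T N))"
  "Src (verdier_shift_cat T N) = Src (localisation T (cone_in T N))"
  "Tgt (verdier_shift_cat T N) = Tgt (localisation T (cone_in T N))"
  "Idt (verdier_shift_cat T N) = Idt (localisation T (cone_in T N))"
  "Cmp (verdier_shift_cat T N) = Cmp (localisation T (cone_in T N))"
  "ShOb (verdier_shift_cat T N) = ShOb T"
  "ShMor (verdier_shift_cat T N) E = zz_cong T (cone_in T N) `` {zz_shift T (rep E)}"
  by (simp_all add: verdier_shift_cat_def cat.extend_def shift_cat.fields_def)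

lemma verdier_quotient_simps:
  "Mor (verdier_quotient T N) = Mor (verdier_shift_cat T N)"
  "Src (verdier_quotient T N) = Src (verdier_shift_cat T N)"
  "Tgt (verdier_quotient T N) = Tgt (verdier_shift_cat T N)"
  "ShOb (verdier_quotient T N) = ShOb (verdier_shift_cat T N)"
  by (simp_all add: verdier_quotient_def)

lemma Dist_verdier_quotient:
  "Dist (verdier_quotient T N) = {t. \<exists>u v w. (u, v, w) \<in> Dist T \<and>
     triangle_iso (verdier_shift_cat T N) (verdier_mor T N u, verdier_mor T N v, verdier_mor T N w) t}"
  unfolding verdier_quotient_def with_triangles_simps by blast

text \<open>If the third object of a distinguished triangle is replaced along a map that becomes
  invertible, the images of the first map and of the modified second one are part of a
  distinguished triangle of the localisation.\<close>

lemma verdier_triangle: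
  fixes T :: "('o, 'm) tri_cat"
  assumes "category T"
    and ShMor_Hom: "\<And>E X Y. E \<in> Hom T X Y \<Longrightarrow> ShMor T E \<in> Hom T (ShOb T X) (ShOb T Y)"
    and ShMor_cone_in: "\<And>s. s \<in> cone_in T N \<Longrightarrow> ShMor T s \<in> cone_in T N"
    and Dist: "(u, v, w) \<in> Dist T"
    and uvw: "u \<in> Hom T X Y" "v \<in> Hom T Y M" "w \<in> Hom T M (ShOb T X)"
    and \<phi>: "\<phi> \<in> Hom T M Z" "\<phi> \<in> cone_in T N"
  shows "\<exists>h \<in> Hom (verdier_quotient T N) Z (ShOb (verdier_quotient T N) X).
    (verdier_mor T N u, verdier_mor T N (Cmp T \<phi> v), h) \<in> Dist (verdier_quotient T N)"
proof -
  interpret T: category T by fact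
  let ?S = "cone_in T N"
  let ?V = "verdier_shift_cat T N"
  interpret zz: cat_congruence "zz_cat T ?S" "zz_cong T ?S" by (rule T.congruence_zz)
  interpret V: category ?V
    by (rule category_transfer[OF T.category_localisation]) (simp_all add: verdier_shift_cat_simps)
  have Hom_V: "Hom ?V A B = Hom (localisation T ?S) A B" for A B
    by (rule Hom_transfer) (simp_all add: verdier_shift_cat_simps)
  have mor: "verdier_mor T N f \<in> Hom ?V A B" if "f \<in> Hom T A B" for f A B
    using T.loc_mor_Hom[OF that] by (simp add: Hom_V verdier_mor_def)
  have mor_Cmp: "verdier_mor T N (Cmp T g f) = Cmp ?V (verdier_mor T N g) (verdier_mor T N f)"
    if "f \<in> Hom T A B" "g \<in> Hom T B D" for f g A B D
    using T.loc_mor_Cmp[OF that] by (simp add: verdier_mor_def verdier_shift_cat_simps)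
  have shift_path: "zz_path T ?S (ShOb T A) (ShOb T B) (map (map_zz_step (ShMor T)) p)"
    if "zz_path T ?S A B p" for A B p
    using that
  proof induction
    case (Nil X)
    then show ?case
      using T.Src_Ob[of "ShMor T (Idt T X)"] ShMor_Hom[OF T.Idt_Hom[OF Nil]]
      by (auto simp: in_Hom_iff intro: zz_path.Nil)
  qed (auto intro: zz_path.intros ShMor_Hom ShMor_cone_in)
  have ShMor_V: "ShMor ?V E \<in> Hom ?V (ShOb T A) (ShOb T B)" if "E \<in> Hom ?V A B" for E A B
  proof -
    have "E \<in> Mor (quot_cat (zz_cat T ?S) (zz_cong T ?S))"
      "Src (quot_cat (zz_cat T ?S) (zz_cong T ?S)) E = A"
      "Tgt (quot_cat (zz_cat T ?S) (zz_cong T ?S)) E = B"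
      using that by (simp_all add: Hom_V localisation_def in_Hom_iff)
    with zz.rep_in_Mor[of E] obtain p where p: "rep E = (A, B, p)" "zz_path T ?S A B p"
      by (cases "rep E") auto
    then have "zz_shift T (rep E) \<in> Mor (zz_cat T ?S)"
      "zz_shift T (rep E) = (ShOb T A, ShOb T B, map (map_zz_step (ShMor T)) p)"
      using shift_path by (simp_all add: zz_shift_def)
    then show ?thesis
      using zz.class_in_Mor[of "zz_shift T (rep E)"]
      by (simp add: Hom_V verdier_shift_cat_simps localisation_def in_Hom_iff)
  qed
  have "is_iso ?V (verdier_mor T N \<phi>) = is_iso (localisation T ?S) (verdier_mor T N \<phi>)"
    by (rule is_iso_transfer) (simp_all add: verdier_shift_cat_simps)
  then have iso: "is_iso ?V (verdier_mor T N \<phi>)"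
    using T.loc_mor_iso[OF \<phi>] by (simp add: verdier_mor_def)
  obtain \<psi> where \<psi>: "\<psi> \<in> Hom ?V Z M" "Cmp ?V \<psi> (verdier_mor T N \<phi>) = Idt ?V M"
    using V.is_isoE[OF iso mor[OF \<phi>(1)]] by metis
  have Ob: "X \<in> Ob ?V" "Y \<in> Ob ?V"
    using mor[OF uvw(1)] V.Src_Ob V.Tgt_Ob by (auto simp: in_Hom_iff)
  let ?e = "ShMor ?V (Idt ?V X)"
  \<comment> \<open>The factor \<open>?e\<close> is a self-map of the shift of \<open>X\<close>; including it in \<open>h\<close> makes the last
    square commute by construction, and it need not be identified with the identity.\<close>
  define h where "h = Cmp ?V ?e (Cmp ?V (verdier_mor T N w) \<psi>)"
  have e: "?e \<in> Hom ?V (ShOb T X) (ShOb T X)"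
    by (rule ShMor_V[OF V.Idt_Hom[OF Ob(1)]])
  note H = mor[OF uvw(1), unfolded in_Hom_iff] mor[OF uvw(2), unfolded in_Hom_iff]
    mor[OF uvw(3), unfolded in_Hom_iff] mor[OF \<phi>(1), unfolded in_Hom_iff]
    \<psi>(1)[unfolded in_Hom_iff] e[unfolded in_Hom_iff]
  have h: "h \<in> Hom ?V Z (ShOb T X)"
    using H by (simp add: h_def in_Hom_iff)
  have h\<phi>: "Cmp ?V h (verdier_mor T N \<phi>) = Cmp ?V ?e (verdier_mor T N w)"
    using H \<psi>(2) by (simp add: h_def)
  have "triangle_iso ?V (verdier_mor T N u, verdier_mor T N v, verdier_mor T N w)
      (verdier_mor T N u, verdier_mor T N (Cmp T \<phi> v), h)"
    unfolding triangle_iso_def split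
    by (intro conjI exI[of _ "Idt ?V X"] exI[of _ "Idt ?V Y"] exI[of _ "verdier_mor T N \<phi>"] iso
        V.is_iso_Idt Ob)
      (use H h h\<phi> mor_Cmp[OF uvw(2) \<phi>(1)] Ob in
        \<open>auto simp: triangle_def in_Hom_iff verdier_shift_cat_simps(7)\<close>)
  moreover have "h \<in> Hom (verdier_quotient T N) Z (ShOb (verdier_quotient T N) X)"
    using h by (simp add: in_Hom_iff verdier_quotient_simps verdier_shift_cat_simps(7))
  ultimately show ?thesis
    using Dist unfolding Dist_verdier_quotient by blast
qed

section \<open>The triangle of an exact sequence split by the functor\<close>

context preadditive_category
begin

lemma kernel_factor:
  assumes "is_kernel (Ch C) (X, Y, u) (Y, Z, v)" "cochain_map C W Y a"
    "\<And>n. v n \<odot> a n = Zer C (cob W n) (cob Z n)" "cochain_complex C W"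
  shows "\<exists>!b. b \<in> Hom (Ch C) W X \<and> Cmp (Ch C) (X, Y, u) b = (W, Y, a)"
proof -
  have "(W, Y, a) \<in> Hom (Ch C) W Y"
    using assms by (auto simp: is_kernel_def in_Hom_iff)
  then show ?thesis
    using assms(1,3) unfolding is_kernel_def by simp
qed

text \<open>A section of the second map of a short exact sequence of complexes yields a retraction of
  the first.\<close>

lemma split_short_exactE:
  assumes "split_short_exact (Ch C) (X, Y, u) (Y, Z, v)"
  obtains r s where "cochain_map C Z Y s" "cochain_map C Y X r"
    "\<And>n. v n \<odot> u n = Zer C (cob X n) (cob Z n)"
    "\<And>n. v n \<odot> s n = Idt C (cob Z n)"
    "\<And>n. Add C (u n \<odot> r n) (s n \<odot> v n) = Idt C (cob Y n)"
    "\<And>n. r n \<odot> u n = Idt C (cob X n)"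
proof -
  interpret Ch: category "Ch C" by (rule category_Ch)
  have ker: "is_kernel (Ch C) (X, Y, u) (Y, Z, v)"
    using assms by (simp add: split_short_exact_def short_exact_def)
  have uv: "cochain_map C X Y u" "cochain_map C Y Z v" "cochain_complex C X"
    "cochain_complex C Y" "cochain_complex C Z"
    and vu: "\<And>n. v n \<odot> u n = Zer C (cob X n) (cob Z n)"
    using ker by (auto simp: is_kernel_def fun_eq_iff)
  obtain s where s: "cochain_map C Z Y s" and vs: "\<And>n. v n \<odot> s n = Idt C (cob Z n)"
    using assms by (auto simp: split_short_exact_def Hom_Ch_iff fun_eq_iff)
  note [simp] = cochain_mapD(1-3)[OF uv(1)] cochain_mapD(1-3)[OF uv(2)] cochain_mapD(1-3)[OF s]
    uv(3-5) vu vs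
  have vsx: "v n \<odot> (s n \<odot> x) = x" if "x \<in> Mor C" "Tgt C x = cob Z n" for n x
    using that Cmp_eq_extend[OF vs, of n x] by simp
  have sv: "cochain_map C Y Y (\<lambda>n. s n \<odot> v n)"
    by (rule cochain_map_Cmp[OF uv(2) s]) simp_all
  \<comment> \<open>The idempotent \<open>1 - s v\<close> is killed by \<open>v\<close>, hence factors through the kernel \<open>u\<close>; the factor is
    the retraction.\<close>
  define a where "a n = Add C (Idt C (cob Y n)) (Neg C (s n \<odot> v n))" for n
  have [simp]: "a n \<in> Mor C" "Src C (a n) = cob Y n" "Tgt C (a n) = cob Y n" for n
    by (simp_all add: a_def)
  have "a (n + 1) \<odot> cdiff Y n = cdiff Y n \<odot> a n" for n
    using cochain_mapD(4)[OF sv, of n] by (simp add: a_def)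
  then have a: "cochain_map C Y Y a"
    by (auto simp: cochain_map_def in_Hom_iff)
  have "v n \<odot> a n = Zer C (cob Y n) (cob Z n)" for n
    by (simp add: a_def vsx)
  then obtain r where r: "cochain_map C Y X r" and ur: "\<And>n. u n \<odot> r n = a n"
    using kernel_factor[OF ker a] uv by (auto simp: Hom_Ch_iff fun_eq_iff elim!: ex1E)
  note [simp] = cochain_mapD(1-3)[OF r]
  have urs: "Add C (u n \<odot> r n) (s n \<odot> v n) = Idt C (cob Y n)" for n
    unfolding ur a_def by (simp add: Add_assoc)
  have ru: "cochain_map C X X (\<lambda>n. r n \<odot> u n)"
    by (rule cochain_map_Cmp[OF uv(1) r]) simp_all
  have "u n \<odot> (r n \<odot> u n) = u n" for n
    using Cmp_eq_extend[OF ur, of n "u n"] by (simp add: a_def)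
  then have "Cmp (Ch C) (X, Y, u) (X, X, \<lambda>n. r n \<odot> u n) = (X, Y, u)"
    "Cmp (Ch C) (X, Y, u) (Idt (Ch C) X) = (X, Y, u)"
    by (simp_all add: fun_eq_iff)
  moreover have "(X, X, \<lambda>n. r n \<odot> u n) \<in> Hom (Ch C) X X" "Idt (Ch C) X \<in> Hom (Ch C) X X"
    using ru cochain_map_Idt by (simp_all add: in_Hom_iff)
  ultimately have "(X, X, \<lambda>n. r n \<odot> u n) = Idt (Ch C) X"
    using kernel_factor[OF ker uv(1) vu uv(3)] by blast
  then have "\<And>n. r n \<odot> u n = Idt C (cob X n)" by (simp add: fun_eq_iff)
  with that s r vu vs urs show thesis by blast
qed

end

theorem proposition7p1:
  fixes A :: "('a, 'f) add_cat" and B :: "('b, 'g) add_cat"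
    and F :: "('a, 'f, 'b, 'g) fnctr"
    and L R :: "('b, 'g, 'a, 'f) fnctr"
    and X Y Z :: "('a, 'f) cochain"
    and f g :: "('a, 'f) cmap"
  assumes "abelian_category A" and "abelian_category B"
    and "faithful_functor A B F" and "additive_functor A B F"
    and "adjunction B A L F" and "adjunction A B F R"
    and "{P. rel_projective A B L P} = {P. rel_injective A B R P}"
    and "f \<in> Hom (Ch A) X Y" and "g \<in> Hom (Ch A) Y Z"
    and "short_exact (Ch A) f g"
    and "split_short_exact (Ch B) (FMor (Ch_fnctr F) f) (FMor (Ch_fnctr F) g)"
  shows "\<exists>h \<in> Hom (D_F A B F) Z (ShOb (D_F A B F) X).
           (D_F_mor A B F f, D_F_mor A B F g, h) \<in> Dist (D_F A B F)"
proof -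
  interpret A: abelian_category A by fact
  interpret B: abelian_category B by fact
  interpret additive_functor_from_abelian A B F
    by unfold_locales (rule assms(4))
  obtain u where u: "f = (X, Y, u)" "cochain_complex A X" "cochain_complex A Y" "cochain_map A X Y u"
    using assms(8) by (auto simp: Hom_Ch_iff)
  obtain v where v: "g = (Y, Z, v)" "cochain_complex A Z" "cochain_map A Y Z v"
    using assms(9) by (auto simp: Hom_Ch_iff)
  note [simp] = u(2,3) v(2) A.cochain_mapD(1-3)[OF u(4)] A.cochain_mapD(1-3)[OF v(3)]
  have vu: "Cmp A (v n) (u n) = Zer A (cob X n) (cob Z n)" for n
    using assms(10) by (auto simp: u v short_exact_def is_kernel_def fun_eq_iff)
  obtain M i j p q where M: "cone A X Y M u i j p q"
    using A.cone_exists[OF A.ex_biproduct u(2-4)] by metis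
  interpret M: cone A X Y M u i j p q by fact
  \<comment> \<open>The comparison map from the cone of \<open>f\<close> to \<open>Z\<close>: it is \<open>v\<close> on the summand \<open>Y\<close> and zero on the
    other one.\<close>
  let ?\<phi> = "\<lambda>n. Cmp A (v n) (q n)"
  have "Cmp A (?\<phi> (n + 1)) (cdiff M n) = Cmp A (cdiff Z n) (?\<phi> n)" for n
    using A.Cmp_eq_extend[OF vu, of "n + 1" "p n"]
    by (simp add: A.cochain_map_diff_Cmp[OF v(3)])
  then have \<phi>: "cochain_map A M Z ?\<phi>"
    by (auto simp: cochain_map_def in_Hom_iff)
  obtain N I J P Q where N: "cone A M Z N ?\<phi> I J P Q"
    using A.cone_exists[OF A.ex_biproduct M.complex_M v(2) \<phi>] by metis
  have split: "split_short_exact (Ch B) (FOb (Ch_fnctr F) X, FOb (Ch_fnctr F) Y, \<lambda>n. FMor F (u n))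
      (FOb (Ch_fnctr F) Y, FOb (Ch_fnctr F) Z, \<lambda>n. FMor F (v n))"
    using assms(11) by (simp add: u v)
  have FN: "cone B (FOb (Ch_fnctr F) M) (FOb (Ch_fnctr F) Z) (FOb (Ch_fnctr F) N)
      (\<lambda>n. Cmp B (FMor F (v n)) (FMor F (q n)))
      (\<lambda>n. FMor F (I n)) (\<lambda>n. FMor F (J n)) (\<lambda>n. FMor F (P n)) (\<lambda>n. FMor F (Q n))"
    using cone_FMor[OF N] by simp
  have "contractible B (FOb (Ch_fnctr F) N)"
    by (rule B.split_short_exactE[OF split],
        rule B.contractible_comparison_cone[OF cone_FMor[OF M] FN FMor_cochain_map[OF v(3) u(3) v(2)]])
      assumption+
  then have \<phi>_S: "K_mor A (M, Z, ?\<phi>) \<in> cone_in (K A) (F_kernel A B F)"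
    by (rule cone_in_kernelI[OF N])
  have "K_mor A g = Cmp (K A) (K_mor A (M, Z, ?\<phi>)) (K_mor A (Y, M, j))"
    using \<phi> M.cochain_map_j by (simp add: A.K_mor_Cmp v(1))
  then have "\<exists>h \<in> Hom (D_F A B F) Z (ShOb (D_F A B F) X).
      (verdier_mor (K A) (F_kernel A B F) (K_mor A (X, Y, u)),
       verdier_mor (K A) (F_kernel A B F) (K_mor A g), h) \<in> Dist (D_F A B F)"
    unfolding D_F_def using M.cochain_map_j M.cochain_map_p \<phi> u(4) A.complex_cshift
    by (auto intro!: verdier_triangle[OF A.category_K _ _ cone_triangle_Dist[OF M], where M = M]
        A.ShMor_K_Hom cone_in_kernel_ShMor A.K_mor_Hom \<phi>_S simp: K_simps(7))
  then show ?thesis by (simp add: D_F_mor_def u(1))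
qed

end
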